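(* Let $h_\nu(z)=2^{\nu}\Gamma(\nu+1)z^{1-\frac{\nu}{2}}J_\nu(\sqrt z)$. (i) If $\nu>-1$, then the radius of uniform convexity $r^{uc}(h_\nu)$ of $h_{\nu}$ is the smallest positive root $r$ of the equation $$1+r^{\frac12}\,\frac{2(\nu-1)J_{\nu+1}(r^{\frac12})-r^{\frac12}J_{\nu}(r^{\frac12})}{2J_{\nu}(r^{\frac12})-r^{\frac12}J_{\nu+1}(r^{\frac12})}=0.$$ Moreover, $r^{uc}(h_{\nu})<\beta_{\nu,1}^{2}<j_{\nu,1}^{2}$, where $\beta_{\nu,1}$ is the first positive zero of the Dini function $z\mapsto(2-\nu)J_{\nu}(z)+zJ_{\nu}'(z)$ and $j_{\nu,1}$ is the first positive zero of $J_\nu$. (ii) If $\nu\in(-2,-1)$, then the radius of uniform convexity $r^{uc}(h_{\nu})$ of $h_\nu$ is the unique root $r$ of the equation $$1+r^{\frac12}\,\frac{r^{\frac12}I_{\nu}(r^{\frac12})-2(\nu-1)I_{\nu+1}(r^{\frac12})}{2I_{\nu}(r^{\frac12})+r^{\frac12}I_{\nu+1}(r^{\frac12})}=0$$ in the interval $(0,b^{2})$, where $b>0$ is such that $\pm ib$ are the purely imaginary zeros of the Dini function $z\mapsto(2-\nu)J_{\nu}(z)+zJ_{\nu}'(z)$.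
   Context: $J_\nu$ is the Bessel function of the first kind of order $\nu$: $J_{\nu}(z)=\sum_{n\ge 0}\frac{(-1)^{n}}{n!\,\Gamma(n+\nu+1)}\left(\frac z2\right)^{2n+\nu}$. $I_\nu$ is the modified Bessel function of the first kind, $I_\nu(z)=i^{-\nu}J_\nu(iz)=\sum_{n\ge0}\frac{1}{n!\,\Gamma(n+\nu+1)}\left(\frac z2\right)^{2n+\nu}$. The normalized function is $h_\nu(z)=2^{\nu}\Gamma(\nu+1)z^{1-\frac{\nu}{2}}J_\nu(\sqrt z)=z-\frac{1}{4(\nu+1)}z^{2}+\dots$ (an entire function). Write $U(r)=\{z\in\mathbb C:|z|<r\}$. For $f(z)=z+\sum_{n\ge2}a_nz^n$ with radius of convergence $r_f\in(0,\infty]$, the radius of uniform convexity is $$r^{uc}(f)=\sup\left\{r\in(0,r_f):\ \operatorname{Re}\left(1+\frac{zf''(z)}{f'(z)}\right)>\left|\frac{zf''(z)}{f'(z)}\right|\ \text{for all } z\in U(r)\right\}.$$ For $\nu\in(-2,-1)$, the function $z\mapsto z^{-\nu}\left[(2-\nu)J_\nu(z)+zJ_\nu'(z)\right]$ has exactly one pair of conjugate purely imaginary zeros, denoted $\pm ib$ with $b>0$, all its other zeros being real. *)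

theory Defs
  imports "HOL-Complex_Analysis.Complex_Analysis"
begin

text \<open>
  Bessel functions of real order on the principal branch.  In the defining series the term
  \<open>(z/2)\<^sup>2\<^sup>n\<^sup>+\<^sup>\<nu>\<close> is written as \<open>(z/2)\<^sup>2\<^sup>n (z/2)\<^sup>\<nu>\<close>, and \<open>rGamma\<close> is \<open>1/\<Gamma>\<close> (equal to 0 at the poles of \<open>\<Gamma>\<close>).
  The order 0 is treated separately only because \<open>0 powr 0 = 0\<close>, whereas the value at the origin
  must be 1.  At the origin the value is meaningless for negative non-integer order.
\<close>

definition bessel_pow :: "real \<Rightarrow> complex \<Rightarrow> complex" where
  "bessel_pow \<nu> w = (if \<nu> = 0 then 1 else w powr complex_of_real \<nu>)"

definition bessel_J :: "real \<Rightarrow> complex \<Rightarrow> complex" where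
  "bessel_J \<nu> z = (\<Sum>n. (-1) ^ n / fact n * complex_of_real (rGamma (real n + \<nu> + 1)) *
                        ((z / 2) ^ (2 * n) * bessel_pow \<nu> (z / 2)))"

definition bessel_I :: "real \<Rightarrow> complex \<Rightarrow> complex" where
  "bessel_I \<nu> z = (\<Sum>n. 1 / fact n * complex_of_real (rGamma (real n + \<nu> + 1)) *
                        ((z / 2) ^ (2 * n) * bessel_pow \<nu> (z / 2)))"

text \<open>
  The principal branches of the power, of the square root and of \<open>bessel_J\<close> are compatible, so
  that the following product is the entire function \<open>z - z\<^sup>2 / (4 (\<nu> + 1)) + \<dots>\<close>, also on the
  branch cut; at the origin \<open>0 powr a = 0\<close> yields the correct value 0.
\<close>

definition bessel_h :: "real \<Rightarrow> complex \<Rightarrow> complex" where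
  "bessel_h \<nu> z = complex_of_real (2 powr \<nu> * Gamma (\<nu> + 1)) *
                   z powr complex_of_real (1 - \<nu> / 2) * bessel_J \<nu> (csqrt z)"

definition dini :: "real \<Rightarrow> complex \<Rightarrow> complex" where
  "dini \<nu> z = complex_of_real (2 - \<nu>) * bessel_J \<nu> z + z * deriv (bessel_J \<nu>) z"

text \<open>
  The supremum is taken in the extended reals, since it may be infinite.  The inequality
  presupposes that the quotient is defined, hence the explicit \<open>deriv f z \<noteq> 0\<close> (otherwise
  \<open>x / 0 = 0\<close> would make it hold at the zeros of \<open>f'\<close>).
\<close>

definition radius_uniform_convexity :: "(complex \<Rightarrow> complex) \<Rightarrow> ereal" where
  "radius_uniform_convexity f =
     Sup {ereal r | r. 0 < r \<and> ereal r < fps_conv_radius (fps_expansion f 0) \<and>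
            (\<forall>z\<in>ball 0 r. deriv f z \<noteq> 0 \<and>
               Re (1 + z * deriv (deriv f) z / deriv f z)
                 > cmod (z * deriv (deriv f) z / deriv f z))}"

definition is_least_pos_zero :: "(real \<Rightarrow> complex) \<Rightarrow> real \<Rightarrow> bool" where
  "is_least_pos_zero g x \<longleftrightarrow> 0 < x \<and> g x = 0 \<and> (\<forall>y. 0 < y \<and> y < x \<longrightarrow> g y \<noteq> 0)"

text \<open>
  Left-hand sides of the two equations for the radius.  With the convention \<open>x / 0 = 0\<close> they
  take the value 1 where the denominator vanishes, so no spurious roots arise there.
\<close>

definition uc_lhs_J :: "real \<Rightarrow> real \<Rightarrow> complex" where
  "uc_lhs_J \<nu> r = (let s = complex_of_real (sqrt r) in
     1 + s * ((2 * (complex_of_real \<nu> - 1) * bessel_J (\<nu> + 1) s - s * bessel_J \<nu> s) /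
              (2 * bessel_J \<nu> s - s * bessel_J (\<nu> + 1) s)))"

definition uc_lhs_I :: "real \<Rightarrow> real \<Rightarrow> complex" where
  "uc_lhs_I \<nu> r = (let s = complex_of_real (sqrt r) in
     1 + s * ((s * bessel_I \<nu> s - 2 * (complex_of_real \<nu> - 1) * bessel_I (\<nu> + 1) s) /
              (2 * bessel_I \<nu> s + s * bessel_I (\<nu> + 1) s)))"

end

theory Submission imports Defs begin

text \<open>
  Write \<open>w = z h''(z) / h'(z)\<close>. Since \<open>Re (1 + w) \<ge> 1 - \<bar>w\<bar>\<close>, the inequality \<open>Re (1 + w) > \<bar>w\<bar>\<close> holds as
  long as \<open>\<bar>w\<bar> < 1/2\<close>, and it fails where \<open>w = -1/2\<close>. If \<open>h'(z) = \<Prod>(1 - c z)\<close>, then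
  \<open>w = -\<Sum> c z / (1 - c z)\<close>. When all \<open>c\<close> are positive (\<open>\<nu> > -1\<close>), \<open>\<bar>w\<bar>\<close> on a circle is largest at the
  positive point; when exactly one \<open>c\<close> is negative and the sum of all \<open>c\<close> is negative
  (\<open>-2 < \<nu> < -1\<close>), it is largest at the negative point. In both cases \<open>w = -1/2\<close> at that point is the
  equation for the radius.

  Instead of the infinite product one uses Jensen polynomials: replacing \<open>1/n!\<close> by \<open>(N choose n) / N\<^sup>n\<close>
  in the series of \<open>h'\<close> gives \<open>(x L(x))'\<close> at \<open>x = z / (4 N)\<close>, where \<open>L\<close> is the Laguerre polynomial of degree
  \<open>N\<close>. Repeated use of Rolle's theorem locates all zeros of these polynomials, and the inequalities
  survive the limit \<open>N \<rightarrow> \<infinity>\<close>, which is uniform on discs.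
\<close>

section \<open>Laguerre polynomials and their zeros\<close>

text \<open>The polynomials stand in for a Hadamard factorisation: products over zeros are formed
  only for them, and the zeros of \<open>h'\<close> as a whole are never listed. What is carried
  through the limit is a pair of non-strict inequalities: a lower bound for the modulus of
  \<open>h'(z)\<close>, and the comparison of \<open>z h''/h'\<close> at \<open>z\<close> with its
  value at \<open>|z|\<close> or \<open>-|z|\<close>, cleared of denominators. The lower bound is
  indispensable, since it alone shows that the limit \<open>h'\<close> has no zero in the disc and
  that one may divide again. The sum of all \<open>c\<close> is negative for \<nu> < -1 because it
  equals 1/(2(\<nu>+1)), the negated linear coefficient of \<open>h'\<close>, which the
  approximation leaves unchanged. The real zeros in the theorem need separate existence arguments.
  For \<nu> > -1 a zero of \<open>h(x)/x\<close> comes from a bound on the smallest Laguerre zero,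
  and Rolle's theorem then places the other zeros below it. For \<nu> < -1 all Taylor coefficients
  of \<open>h'(-x)\<close> after the first are nonpositive, so monotonicity suffices.\<close>

lemma poly_eq_prod_roots:
  fixes p :: "'a::field poly"
  assumes "finite A" "card A = degree p" "\<And>a. a \<in> A \<Longrightarrow> poly p a = 0" "poly p 0 = 1"
  shows "p = (\<Prod>a\<in>A. [:1, - (1 / a):])"
  using assms
proof (induction A arbitrary: p rule: finite_induct)
  case empty
  then have "degree p = 0" by simp
  with empty.prems(3) show ?case
    by (auto elim!: degree_eq_zeroE simp: one_pCons)
next
  case (insert a A)
  have a0: "a \<noteq> 0" using insert.prems by (metis insertI1 zero_neq_one)
  from insert.prems(2)[of a] obtain q where "p = [:-a, 1:] * q"
    by (auto simp: poly_eq_0_iff_dvd elim: dvdE)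
  then have p: "p = [:1, - (1 / a):] * smult (-a) q" using a0 by (simp add: mult_ac)
  \<comment> \<open>Rescaling the quotient restores the value 1 at 0, which the induction hypothesis
    requires.\<close>
  define r where "r = smult (-a) q"
  have p: "p = [:1, - (1 / a):] * r" using p by (simp add: r_def)
  have r0: "poly r 0 = 1" using insert.prems(3) p by simp
  then have "r \<noteq> 0" by auto
  then have deg: "degree p = Suc (degree r)"
    unfolding p by (subst degree_mult_eq) (use a0 in auto)
  have pr: "poly p y = (1 - y / a) * poly r y" for y
    by (simp add: p left_diff_distrib)
  have "poly r b = 0" if "b \<in> A" for b
  proof -
    have "b \<noteq> a" using that insert.hyps(2) by auto
    with a0 pr[of b] insert.prems(2)[of b] that show ?thesis by simp
  qed
  then have "r = (\<Prod>a\<in>A. [:1, - (1 / a):])"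
    using insert.prems(1) insert.hyps deg r0 by (intro insert.IH) auto
  then show ?case using insert.hyps by (simp add: p)
qed

text \<open>These are Newton's identities in degrees 1 and 2: they turn explicitly known
  coefficients into sums of reciprocal roots and of their squares.\<close>

lemma coeff_prod_linear:
  fixes g :: "'b \<Rightarrow> 'a::comm_ring_1"
  assumes "finite A"
  shows "coeff (\<Prod>a\<in>A. [:1, - g a:]) 0 = 1"
    and "coeff (\<Prod>a\<in>A. [:1, - g a:]) 1 = - sum g A"
    and "2 * coeff (\<Prod>a\<in>A. [:1, - g a:]) 2 = (sum g A)\<^sup>2 - (\<Sum>a\<in>A. (g a)\<^sup>2)"
  using assms
proof (induction A rule: finite_induct)
  case (insert a A)
  { case 1 show ?case using insert by simp }
  { case 2 show ?case using insert by simp }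
  { case 3
    have "2 * coeff (\<Prod>a\<in>insert a A. [:1, - g a:]) 2 =
        2 * coeff (\<Prod>a\<in>A. [:1, - g a:]) 2 - 2 * g a * coeff (\<Prod>a\<in>A. [:1, - g a:]) 1"
      using insert.hyps by (simp add: numeral_2_eq_2 algebra_simps)
    then show ?case using insert by (simp add: power2_eq_square algebra_simps) }
qed auto

section \<open>Rolle's theorem for finite sets of zeros and on half-lines\<close>

lemma Rolle_between_zeros:
  fixes f f' :: "real \<Rightarrow> real"
  assumes "a < b" "f a = 0" "f b = 0" "continuous_on {a..b} f"
    and deriv: "\<And>x. a < x \<Longrightarrow> x < b \<Longrightarrow> (f has_real_derivative f' x) (at x)"
  obtains x where "a < x" "x < b" "f' x = 0"
proof -
  obtain z where z: "a < z" "z < b" "DERIV f z :> 0"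
    using Rolle[of a b f] assms by (auto simp: real_differentiable_def)
  with DERIV_unique[OF z(3) deriv[OF z(1,2)]] that show ?thesis by simp
qed

text \<open>The set grows by a new minimum \<open>b\<close>. The clause \<open>Min A < x\<close>
  places all earlier critical points above the old minimum, so the one found between
  \<open>b\<close> and that minimum is new.\<close>

lemma Rolle_finite:
  fixes f f' :: "real \<Rightarrow> real"
  assumes "finite A" "A \<noteq> {}" "\<And>x. x \<in> A \<Longrightarrow> f x = 0" "\<And>x. (f has_real_derivative f' x) (at x)"
  shows "\<exists>B. finite B \<and> Suc (card B) = card A \<and> (\<forall>x\<in>B. Min A < x \<and> f' x = 0)"
  using assms(1-3)
proof (induction A rule: finite_linorder_min_induct)
  case (insert b A)
  show ?case
  proof (cases "A = {}")
    case False
    with insert obtain B where B: "finite B" "Suc (card B) = card A" "\<forall>x\<in>B. Min A < x \<and> f' x = 0"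
      by auto
    have b: "b < Min A" using insert.hyps False by simp
    have "continuous_on {b..Min A} f"
      using DERIV_isCont[OF assms(4)] by (intro continuous_at_imp_continuous_on) auto
    then obtain x where x: "b < x" "x < Min A" "f' x = 0"
      using Rolle_between_zeros[OF b, of f f'] insert.prems(2) insert.hyps False assms(4) by auto
    have "Min (insert b A) = b" using b insert.hyps False by simp
    moreover have "b \<notin> A" "x \<notin> B" using insert.hyps B x by auto
    ultimately show ?thesis using B x b insert.hyps
      by (intro exI[of _ "insert x B"]) auto
  qed (auto intro!: exI[of _ "{}"])
qed auto

text \<open>Decay at infinity acts as a second zero: the maximum of the modulus of \<open>f\<close>
  is attained in the interior. The derivative test is applied to the square of \<open>f\<close>,
  which is differentiable where the modulus need not be. At \<open>a\<close> only continuity is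
  assumed, because a real power such as \<open>x powr (\<alpha> + 1)\<close> need not be
  differentiable at 0.\<close>

lemma Rolle_at_top:
  fixes f f' :: "real \<Rightarrow> real"
  assumes cont: "continuous_on {a..} f" and "f a = 0"
    and deriv: "\<And>x. x > a \<Longrightarrow> (f has_real_derivative f' x) (at x)"
    and lim: "(f \<longlongrightarrow> 0) at_top"
  shows "\<exists>x>a. f' x = 0"
proof (cases "f (a + 1) = 0")
  case True
  have "continuous_on {a..a + 1} f" by (rule continuous_on_subset[OF cont]) auto
  then show ?thesis
    using Rolle_between_zeros[of a "a + 1" f f'] True assms by auto
next
  case False
  have "\<forall>\<^sub>F x in at_top. \<bar>f x\<bar> < \<bar>f (a + 1)\<bar>"
    using tendsto_rabs[OF lim] False by (intro order_tendstoD(2)[where y=0]) auto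
  then obtain d where d: "\<And>x. x \<ge> d \<Longrightarrow> \<bar>f x\<bar> < \<bar>f (a + 1)\<bar>" by (auto simp: eventually_at_top_linorder)
  \<comment> \<open>Beyond \<open>d\<close> the modulus is below its value at \<open>a + 1\<close>;
    taking \<open>e\<close> at least \<open>a + 1\<close> keeps that point in the interval, so the
    maximum is not attained at \<open>e\<close>.\<close>
  define e where "e = max d (a + 1)"
  have "\<exists>x\<in>{a..e}. \<forall>y\<in>{a..e}. \<bar>f y\<bar> \<le> \<bar>f x\<bar>"
    by (intro continuous_attains_sup continuous_intros continuous_on_subset[OF cont]) (auto simp: e_def)
  then obtain x where x: "x \<in> {a..e}" "\<And>y. y \<in> {a..e} \<Longrightarrow> \<bar>f y\<bar> \<le> \<bar>f x\<bar>" by auto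
  have ge: "\<bar>f (a + 1)\<bar> \<le> \<bar>f x\<bar>" using x by (auto simp: e_def)
  then have "x \<noteq> a" "x \<noteq> e" using d[of e] False \<open>f a = 0\<close> by (auto simp: e_def)
  then have xx: "a < x" "x < e" using x by auto
  have "((\<lambda>x. (f x)\<^sup>2) has_real_derivative 2 * f x * f' x) (at x)"
    by (auto intro!: derivative_eq_intros deriv xx)
  then have "2 * f x * f' x = 0"
    using xx x(2)
    by (intro DERIV_local_max[where d="min (x - a) (e - x)"]) (auto simp flip: abs_le_square_iff intro!: x(2) simp: abs_less_iff)
  then show ?thesis using xx ge False by auto
qed

text \<open>No zero is lost here: besides the gaps between neighbours, the unbounded interval above
  the largest zero contributes one critical point.\<close>

lemma Rolle_finite_at_top:
  fixes f f' :: "real \<Rightarrow> real"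
  assumes "finite A" "A \<noteq> {}" "\<And>x. x \<in> A \<Longrightarrow> f x = 0"
    and "continuous_on {Min A..} f"
    and "\<And>x. x > Min A \<Longrightarrow> (f has_real_derivative f' x) (at x)"
    and lim: "(f \<longlongrightarrow> 0) at_top"
  shows "\<exists>B. finite B \<and> card B = card A \<and> (\<forall>x\<in>B. Min A < x \<and> f' x = 0)"
  using assms(1-5)
proof (induction A rule: finite_linorder_min_induct)
  case (insert b A)
  show ?case
  proof (cases "A = {}")
    case True
    with insert.prems obtain x where "x > b" "f' x = 0"
      using Rolle_at_top[OF _ _ _ lim, of b f'] by auto
    with True show ?thesis by (intro exI[of _ "{x}"]) auto
  next
    case False
    have b: "b < Min A" and Mb: "Min (insert b A) = b"
      using insert.hyps False by auto
    note prems = insert.prems(2-4)[unfolded Mb]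
    have "\<exists>B. finite B \<and> card B = card A \<and> (\<forall>x\<in>B. Min A < x \<and> f' x = 0)"
      using b False by (intro insert.IH prems continuous_on_subset[OF prems(2)]) auto
    then obtain B where B: "finite B" "card B = card A" "\<forall>x\<in>B. Min A < x \<and> f' x = 0"
      by auto
    have "continuous_on {b..Min A} f" by (rule continuous_on_subset[OF prems(2)]) auto
    then obtain x where x: "b < x" "x < Min A" "f' x = 0"
      using Rolle_between_zeros[OF b, of f f'] prems insert.hyps False by auto
    have "b \<notin> A" "x \<notin> B" using insert.hyps B x by auto
    then show ?thesis using B x b insert.hyps Mb
      by (intro exI[of _ "insert x B"]) auto
  qed
qed auto

text \<open>Normalised to take the value 1 at 0.\<close>

definition laguerre :: "nat \<Rightarrow> real \<Rightarrow> real poly" where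
  "laguerre N \<alpha> = (\<Sum>n\<le>N. monom ((-1) ^ n * real (N choose n) / pochhammer (\<alpha> + 1) n) n)"

lemma coeff_laguerre:
  "coeff (laguerre N \<alpha>) n = (-1) ^ n * real (N choose n) / pochhammer (\<alpha> + 1) n"
  by (simp add: laguerre_def coeff_sum if_distrib sum.delta cong: if_cong)

lemma poly_laguerre_0: "poly (laguerre N \<alpha>) 0 = 1"
  by (simp add: poly_0_coeff_0 coeff_laguerre)

lemma degree_laguerre_le: "degree (laguerre N \<alpha>) \<le> N"
  by (rule degree_le) (simp add: coeff_laguerre)

text \<open>Comparing coefficients reduces this to Pascal's rule. The hypotheses make
  \<open>\<alpha> + 1\<close> and all \<open>\<alpha> + 2 + m\<close> nonzero, so the Pochhammer
  symbols cancel.\<close>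

lemma laguerre_Suc:
  assumes "\<alpha> > -2" "\<alpha> \<noteq> -1"
  shows "smult (\<alpha> + 1) (laguerre (Suc N) \<alpha>) =
    [:0, 1:] * pderiv (laguerre N (\<alpha> + 1)) + [:\<alpha> + 1, -1:] * laguerre N (\<alpha> + 1)" (is "?l = ?r")
proof (rule poly_eqI)
  fix n
  show "coeff ?l n = coeff ?r n"
  proof (cases n)
    case 0
    then show ?thesis by (simp add: coeff_laguerre)
  next
    case (Suc m)
    define P where "P = pochhammer (\<alpha> + 1 + 1) m"
    have P1: "pochhammer (\<alpha> + 1) (Suc m) = (\<alpha> + 1) * P" by (simp add: P_def pochhammer_rec)
    have P2: "pochhammer (\<alpha> + 1 + 1) (Suc m) = P * (\<alpha> + 2 + real m)" by (simp add: P_def pochhammer_rec' mult.commute)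
    have s0: "\<alpha> + 2 + real m \<noteq> 0" using assms by linarith
    have *: "(\<alpha> + 2 + real m) * (x / (P * (\<alpha> + 2 + real m))) = x / P" for x
      using s0 by simp
    have "coeff ?r n = (\<alpha> + 2 + real m) * coeff (laguerre N (\<alpha>+1)) (Suc m) - coeff (laguerre N (\<alpha>+1)) m"
      using Suc by (simp add: coeff_pderiv algebra_simps)
    also have "\<dots> = - ((-1) ^ m * real (N choose Suc m) / P) - (-1) ^ m * real (N choose m) / P"
      unfolding coeff_laguerre P2 using * by (simp add: P_def)
    also have "\<dots> = coeff ?l n"
      using assms Suc by (simp add: coeff_laguerre P1 divide_simps) (simp add: algebra_simps)
    finally show ?thesis ..
  qed
qed

text \<open>The exponent is kept general in the induction, so that the factor \<open>x\<close> split
  off from the polynomial can be absorbed into the power.\<close>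

lemma tendsto_powr_exp_poly_at_top:
  fixes p :: "real poly"
  shows "((\<lambda>x. x powr a * exp (- x) * poly p x) \<longlongrightarrow> 0) at_top"
proof (induction p arbitrary: a)
  case 0
  then show ?case by simp
next
  case (pCons c p)
  have "((\<lambda>x::real. x ^ nat \<lceil>\<bar>a\<bar>\<rceil> / exp x) \<longlongrightarrow> 0) at_top"
    by (rule tendsto_power_div_exp_0)
  then have *: "((\<lambda>x::real. x powr a * exp (- x)) \<longlongrightarrow> 0) at_top"
  proof (rule Lim_null_comparison[rotated])
    show "\<forall>\<^sub>F x in at_top. norm (x powr a * exp (- x)) \<le> x ^ nat \<lceil>\<bar>a\<bar>\<rceil> / exp x"
      using eventually_ge_at_top[of 1]
    proof eventually_elim
      case (elim x)
      have "x powr a \<le> x powr real (nat \<lceil>\<bar>a\<bar>\<rceil>)"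
        using elim by (intro powr_mono) linarith+
      also have "\<dots> = x ^ nat \<lceil>\<bar>a\<bar>\<rceil>" using elim by (intro powr_realpow) auto
      finally show ?case using elim by (simp add: exp_minus divide_simps)
    qed
  qed
  have "((\<lambda>x. c * (x powr a * exp (- x)) + x powr (a + 1) * exp (- x) * poly p x) \<longlongrightarrow> c * 0 + 0) at_top"
    by (intro tendsto_add tendsto_mult tendsto_const * pCons.IH)
  then have "((\<lambda>x. c * (x powr a * exp (- x)) + x powr (a + 1) * exp (- x) * poly p x) \<longlongrightarrow> 0) at_top"
    by simp
  then show ?case
  proof (rule Lim_transform_eventually)
    show "\<forall>\<^sub>F x in at_top. c * (x powr a * exp (- x)) + x powr (a + 1) * exp (- x) * poly p x =
            x powr a * exp (- x) * poly (pCons c p) x"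
      using eventually_gt_at_top[of 0]
      by eventually_elim (simp add: powr_add algebra_simps)
  qed
qed

text \<open>By \<open>laguerre_Suc\<close>, the polynomial \<open>laguerre (Suc N) \<alpha>\<close> is, up to nonvanishing factors, the
  derivative of \<open>x\<^sup>\<alpha>\<^sup>+\<^sup>1 e\<^sup>-\<^sup>x laguerre N (\<alpha> + 1)\<close>.\<close>

lemma laguerre_zeros_Rolle:
  fixes \<alpha> :: real
  defines "F \<equiv> \<lambda>N x. x powr (\<alpha> + 1) * exp (- x) * poly (laguerre N (\<alpha> + 1)) x"
  assumes "\<alpha> > -2" "\<alpha> \<noteq> -1" and A: "finite A" "A \<noteq> {}" "\<And>x. x \<in> A \<Longrightarrow> F N x = 0"
    and M: "Min A \<ge> 0" "continuous_on {Min A..} (F N)"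
  shows "\<exists>B. finite B \<and> card B = card A \<and> (\<forall>x\<in>B. Min A < x \<and> poly (laguerre (Suc N) \<alpha>) x = 0)"
proof -
  define g where "g = (\<lambda>x. x powr \<alpha> * exp (- x) * ((\<alpha> + 1) * poly (laguerre (Suc N) \<alpha>) x))"
  have g: "(F N has_real_derivative g x) (at x)" if "x > 0" for x
  proof -
    have "(\<alpha> + 1) * poly (laguerre (Suc N) \<alpha>) x =
            poly (smult (\<alpha> + 1) (laguerre (Suc N) \<alpha>)) x" by simp
    also have "\<dots> = x * poly (pderiv (laguerre N (\<alpha> + 1))) x + (\<alpha> + 1 - x) * poly (laguerre N (\<alpha> + 1)) x"
      using assms(2,3) by (subst laguerre_Suc) (simp_all add: left_diff_distrib)
    finally have eq: "(\<alpha> + 1) * poly (laguerre (Suc N) \<alpha>) x = \<dots>" .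
    have "((\<lambda>x. x powr (\<alpha> + 1)) has_real_derivative (\<alpha> + 1) * x powr \<alpha>) (at x)"
      using has_real_derivative_powr[OF that, of "\<alpha> + 1"] by simp
    moreover have "((\<lambda>x. exp (- x)) has_real_derivative - exp (- x)) (at x)"
      by (auto intro!: derivative_eq_intros)
    ultimately have "(F N has_real_derivative
        ((\<alpha> + 1) * x powr \<alpha> * exp (- x) + (- exp (- x)) * x powr (\<alpha> + 1)) * poly (laguerre N (\<alpha> + 1)) x
        + poly (pderiv (laguerre N (\<alpha> + 1))) x * (x powr (\<alpha> + 1) * exp (- x))) (at x)"
      unfolding F_def by (intro DERIV_mult poly_DERIV)
    then show ?thesis
      unfolding g_def eq using that by (simp add: powr_add algebra_simps)
  qed
  have "\<exists>B. finite B \<and> card B = card A \<and> (\<forall>x\<in>B. Min A < x \<and> g x = 0)"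
  proof (rule Rolle_finite_at_top[OF A M(2)])
    show "(F N \<longlongrightarrow> 0) at_top"
      unfolding F_def by (rule tendsto_powr_exp_poly_at_top)
    show "(F N has_real_derivative g x) (at x)" if "Min A < x" for x
      using M(1) that by (intro g) simp
  qed
  then obtain B where B: "finite B" "card B = card A" "\<forall>x\<in>B. Min A < x \<and> g x = 0" by blast
  have "poly (laguerre (Suc N) \<alpha>) x = 0" if "x \<in> B" for x
  proof -
    have "x > 0" "g x = 0" using B(3) that M(1) by (auto intro: le_less_trans)
    with assms(3) show ?thesis by (simp add: g_def)
  qed
  with B show ?thesis by blast
qed

section \<open>Location of the zeros of Laguerre polynomials and of their companions\<close>

text \<open>Raising the degree lowers the parameter, hence the induction runs over all \<alpha>.
  Since \<open>\<alpha> + 1 > 0\<close>, the power vanishes continuously at 0 and supplies one zero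
  in addition to the \<open>N\<close> known ones; with the decay at infinity, Rolle's theorem yields
  \<open>N + 1\<close>.\<close>

lemma laguerre_zeros_pos:
  assumes "\<alpha> > -1"
  shows "\<exists>A. finite A \<and> card A = N \<and> (\<forall>x\<in>A. 0 < x \<and> poly (laguerre N \<alpha>) x = 0)"
  using assms
proof (induction N arbitrary: \<alpha>)
  case 0
  then show ?case by (intro exI[of _ "{}"]) auto
next
  case (Suc N)
  then have "\<alpha> + 1 > -1" by simp
  from Suc.IH[OF this] obtain A
    where A: "finite A" "card A = N" "\<forall>x\<in>A. 0 < x \<and> poly (laguerre N (\<alpha> + 1)) x = 0"
    by blast
  have M: "Min (insert 0 A) = 0"
    using A by (intro Min_eqI) auto
  have "\<exists>B. finite B \<and> card B = card (insert 0 A) \<and>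
          (\<forall>x\<in>B. Min (insert 0 A) < x \<and> poly (laguerre (Suc N) \<alpha>) x = 0)"
    using Suc.prems A unfolding M
    by (intro laguerre_zeros_Rolle[of \<alpha> "insert 0 A" N, unfolded M])
       (auto intro!: continuous_intros continuous_on_powr')
  moreover have "card (insert 0 A) = Suc N" using A by (subst card_insert_disjoint) auto
  ultimately show ?case unfolding M by auto
qed

text \<open>Now the exponent \<open>\<alpha> + 1\<close> is negative and the origin can no longer
  serve as an endpoint, so Rolle's theorem yields only \<open>N\<close> positive zeros. The missing
  zero is negative and comes from a sign change.\<close>

lemma laguerre_zeros_neg:
  assumes "-2 < \<alpha>" "\<alpha> < -1"
  shows "\<exists>A a. finite A \<and> card A = N \<and> (\<forall>x\<in>A. 0 < x \<and> poly (laguerre (Suc N) \<alpha>) x = 0)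
           \<and> a < 0 \<and> poly (laguerre (Suc N) \<alpha>) a = 0"
proof -
  have "\<exists>B. finite B \<and> card B = N \<and> (\<forall>x\<in>B. 0 < x \<and> poly (laguerre (Suc N) \<alpha>) x = 0)"
  proof (cases "N = 0")
    case True
    then show ?thesis by (intro exI[of _ "{}"]) auto
  next
    case False
    have "\<alpha> + 1 > -1" using assms by simp
    from laguerre_zeros_pos[OF this] obtain A
      where A: "finite A" "card A = N" "\<forall>x\<in>A. 0 < x \<and> poly (laguerre N (\<alpha> + 1)) x = 0"
      by blast
    with False have ne: "A \<noteq> {}" by auto
    then have M: "Min A > 0" using A by (subst Min_gr_iff) auto
    have "\<exists>B. finite B \<and> card B = card A \<and>
          (\<forall>x\<in>B. Min A < x \<and> poly (laguerre (Suc N) \<alpha>) x = 0)"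
    proof (rule laguerre_zeros_Rolle)
      show "continuous_on {Min A..} (\<lambda>x. x powr (\<alpha> + 1) * exp (- x) * poly (laguerre N (\<alpha> + 1)) x)"
        using M by (intro continuous_intros ballI) (metis atLeast_iff not_less)
    qed (use assms A ne M in \<open>auto simp: less_imp_le\<close>)
    then show ?thesis using A M by (metis less_trans)
  qed
  moreover have "\<exists>a<0. poly (laguerre (Suc N) \<alpha>) a = 0"
  proof -
    \<comment> \<open>At this point the constant and the linear term cancel. All higher terms are
      nonpositive, since each Pochhammer symbol has the single negative factor
      \<open>\<alpha> + 1\<close>.\<close>
    define x where "x = (\<alpha> + 1) / real (Suc N)"
    have x0: "x < 0" using assms by (simp add: x_def divide_neg_pos)
    have poch: "pochhammer (\<alpha> + 1) n < 0" if n: "n \<ge> 1" for n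
    proof -
      obtain m where "n = Suc m" using n by (cases n) auto
      then show ?thesis using assms by (auto simp: pochhammer_rec intro!: mult_neg_pos pochhammer_pos)
    qed
    have "poly (laguerre (Suc N) \<alpha>) x =
            (\<Sum>n\<le>Suc N. (-1) ^ n * real (Suc N choose n) / pochhammer (\<alpha> + 1) n * x ^ n)"
      by (simp add: laguerre_def poly_sum poly_monom)
    also have "\<dots> = (\<Sum>n\<le>Suc N. real (Suc N choose n) * (- x) ^ n / pochhammer (\<alpha> + 1) n)"
      by (intro sum.cong) (auto simp: power_minus[of x] field_simps)
    also have "\<dots> \<le> (\<Sum>n\<in>{0,1}. real (Suc N choose n) * (- x) ^ n / pochhammer (\<alpha> + 1) n)"
    proof -
      have "(\<Sum>n\<in>{..Suc N} - {0,1}. real (Suc N choose n) * (- x) ^ n / pochhammer (\<alpha> + 1) n) \<le> 0"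
      proof (rule sum_nonpos)
        fix n assume "n \<in> {..Suc N} - {0,1}"
        then have "pochhammer (\<alpha> + 1) n < 0" by (intro poch) auto
        then show "real (Suc N choose n) * (- x) ^ n / pochhammer (\<alpha> + 1) n \<le> 0"
          using x0 by (intro divide_nonneg_neg mult_nonneg_nonneg zero_le_power) auto
      qed
      then show ?thesis
        by (subst sum.subset_diff[of "{0,1}"]) auto
    qed
    also have "\<dots> = 0" using assms by (simp add: x_def divide_simps)
    finally have "poly (laguerre (Suc N) \<alpha>) x \<le> 0" .
    moreover have "continuous_on {x..0} (poly (laguerre (Suc N) \<alpha>))"
      by (intro continuous_intros)
    ultimately obtain a where "x \<le> a" "a \<le> 0" "poly (laguerre (Suc N) \<alpha>) a = 0"
      using IVT'[of "poly (laguerre (Suc N) \<alpha>)" x 0 0] x0 by (auto simp: poly_laguerre_0)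
    then show ?thesis using poly_laguerre_0[of "Suc N" \<alpha>] by (metis less_eq_real_def zero_neq_one)
  qed
  ultimately show ?thesis by blast
qed

text \<open>At \<open>z / (4 N)\<close> these polynomials converge to \<open>h\<^sub>\<nu>'(z)\<close>.\<close>

definition dlaguerre :: "nat \<Rightarrow> real \<Rightarrow> real poly" where
  "dlaguerre N \<alpha> = pderiv ([:0, 1:] * laguerre N \<alpha>)"

lemma coeff_dlaguerre: "coeff (dlaguerre N \<alpha>) n = (real n + 1) * coeff (laguerre N \<alpha>) n"
  by (simp add: dlaguerre_def coeff_pderiv)

lemma poly_dlaguerre_0: "poly (dlaguerre N \<alpha>) 0 = 1"
  by (simp add: poly_0_coeff_0 coeff_dlaguerre coeff_laguerre)

lemma degree_dlaguerre_le: "degree (dlaguerre N \<alpha>) \<le> N"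
  by (rule degree_le) (simp add: coeff_dlaguerre coeff_laguerre)

lemma dlaguerre_zeros_Rolle:
  assumes "finite A" "A \<noteq> {}" "\<And>x. x \<in> A \<Longrightarrow> x * poly (laguerre N \<alpha>) x = 0"
  shows "\<exists>B. finite B \<and> Suc (card B) = card A \<and> (\<forall>x\<in>B. Min A < x \<and> poly (dlaguerre N \<alpha>) x = 0)"
proof -
  have "((\<lambda>x. x * poly (laguerre N \<alpha>) x) has_real_derivative poly (dlaguerre N \<alpha>) x) (at x)" for x
    using poly_DERIV[of "[:0, 1:] * laguerre N \<alpha>" x] by (simp add: dlaguerre_def)
  with assms show ?thesis
    by (intro Rolle_finite[where f="\<lambda>x. x * poly (laguerre N \<alpha>) x"]) blast+
qed

text \<open>The factor \<open>x\<close> in \<open>x L(x)\<close> adds the zero 0, which compensates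
  for the one lost by Rolle's theorem. The number \<open>N\<close> of zeros is independent of the
  degree \<open>M\<close>, so that the case with one negative zero is covered as well.\<close>

lemma dlaguerre_zeros_pos:
  assumes A: "finite A" "card A = N" "\<forall>x\<in>A. 0 < x \<and> poly (laguerre M \<alpha>) x = 0"
  shows "\<exists>B. finite B \<and> card B = N \<and> (\<forall>x\<in>B. 0 < x \<and> poly (dlaguerre M \<alpha>) x = 0)"
proof -
  have "Min (insert 0 A) = 0" using A by (intro Min_eqI) auto
  moreover have "card (insert 0 A) = Suc N" using A by (subst card_insert_disjoint) auto
  ultimately show ?thesis using dlaguerre_zeros_Rolle[of "insert 0 A" M \<alpha>] A by auto
qed

lemma dlaguerre_zeros_neg:
  assumes "a < 0" "poly (laguerre M \<alpha>) a = 0"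
  shows "\<exists>b<0. poly (dlaguerre M \<alpha>) b = 0"
proof -
  have d: "((\<lambda>x. x * poly (laguerre M \<alpha>) x) has_real_derivative poly (dlaguerre M \<alpha>) x) (at x)" for x
    using poly_DERIV[of "[:0, 1:] * laguerre M \<alpha>" x] by (simp add: dlaguerre_def)
  have "continuous_on {a..0} (\<lambda>x. x * poly (laguerre M \<alpha>) x)"
    by (intro continuous_intros)
  then show ?thesis using Rolle_between_zeros[OF assms(1) _ _ _ d] assms(2) by auto
qed

section \<open>Everywhere convergent power series\<close>

definition entire_coeffs :: "(nat \<Rightarrow> real) \<Rightarrow> bool" where
  "entire_coeffs c \<longleftrightarrow> (\<forall>r. summable (\<lambda>n. \<bar>c n\<bar> * r ^ n))"

text \<open>Polymorphic because the same real coefficients are evaluated at complex points and at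
  the real comparison points \<open>|z|\<close> and \<open>-|z|\<close>.\<close>

definition pow_series :: "(nat \<Rightarrow> real) \<Rightarrow> 'a \<Rightarrow> 'a::{real_normed_field,banach}" where
  "pow_series c z = (\<Sum>n. of_real (c n) * z ^ n)"

lemma entire_coeffs_summable_norm:
  assumes "entire_coeffs c"
  shows "summable (\<lambda>n. norm (of_real (c n) * z ^ n :: 'a::{real_normed_field,banach}))"
  using assms by (simp add: entire_coeffs_def norm_mult norm_power)

lemma entire_coeffs_summable:
  assumes "entire_coeffs c"
  shows "summable (\<lambda>n. of_real (c n) * z ^ n :: 'a::{real_normed_field,banach})"
  using entire_coeffs_summable_norm[OF assms] by (rule summable_norm_cancel)

text \<open>The factor \<open>2 ^ n\<close> is absorbed by doubling the radius; it leaves room for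
  the factors \<open>n\<close> and \<open>n + 1\<close> produced by differentiation.\<close>

lemma entire_coeffs_bound:
  assumes "entire_coeffs c" "\<And>n. \<bar>d n\<bar> \<le> 2 ^ n * \<bar>c n\<bar>"
  shows "entire_coeffs d"
  unfolding entire_coeffs_def
proof
  fix r :: real
  have "summable (\<lambda>n. \<bar>c n\<bar> * (2 * \<bar>r\<bar>) ^ n)"
    using assms(1) unfolding entire_coeffs_def by blast
  moreover have "norm (\<bar>d n\<bar> * r ^ n) \<le> \<bar>c n\<bar> * (2 * \<bar>r\<bar>) ^ n" for n
    using mult_right_mono[OF assms(2), of "\<bar>r\<bar> ^ n" n]
    by (simp add: abs_mult power_abs power_mult_distrib mult_ac)
  ultimately show "summable (\<lambda>n. \<bar>d n\<bar> * r ^ n)"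
    by (rule summable_comparison_test'[where N=0])
qed

lemma entire_coeffs_mult_bounded:
  assumes "entire_coeffs c" "\<And>n. \<bar>d n\<bar> \<le> 1"
  shows "entire_coeffs (\<lambda>n. d n * c n)"
proof (rule entire_coeffs_bound[OF assms(1)])
  fix n
  have "\<bar>d n\<bar> \<le> 2 ^ n" using assms(2)[of n] one_le_power[of "2::real" n] by linarith
  then show "\<bar>d n * c n\<bar> \<le> 2 ^ n * \<bar>c n\<bar>" by (simp add: abs_mult mult_right_mono)
qed

lemma entire_coeffs_Suc_mult:
  assumes "entire_coeffs c"
  shows "entire_coeffs (\<lambda>n. (real n + 1) * c n)"
proof (rule entire_coeffs_bound[OF assms])
  fix n
  have "real n + 1 \<le> 2 ^ n" using less_exp[of n]
    by (metis Suc_leI of_nat_Suc of_nat_le_iff of_nat_numeral of_nat_power add.commute)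
  then show "\<bar>(real n + 1) * c n\<bar> \<le> 2 ^ n * \<bar>c n\<bar>" by (simp add: abs_mult mult_right_mono)
qed

lemma entire_coeffs_nat_mult:
  assumes "entire_coeffs c"
  shows "entire_coeffs (\<lambda>n. real n * c n)"
  by (rule entire_coeffs_bound[OF assms]) (auto simp: abs_mult intro!: mult_right_mono less_imp_le[OF of_nat_less_two_power])

lemma entire_coeffs_add:
  assumes "entire_coeffs c" "entire_coeffs d"
  shows "entire_coeffs (\<lambda>n. c n + d n)"
  unfolding entire_coeffs_def
proof
  fix r :: real
  have "summable (\<lambda>n. \<bar>c n\<bar> * \<bar>r\<bar> ^ n + \<bar>d n\<bar> * \<bar>r\<bar> ^ n)"
    using assms by (intro summable_add) (auto simp: entire_coeffs_def)
  moreover have "norm (\<bar>c n + d n\<bar> * r ^ n) \<le> \<bar>c n\<bar> * \<bar>r\<bar> ^ n + \<bar>d n\<bar> * \<bar>r\<bar> ^ n" for n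
    by (auto simp: abs_mult power_abs simp flip: distrib_right intro!: mult_right_mono)
  ultimately show "summable (\<lambda>n. \<bar>c n + d n\<bar> * r ^ n)"
    by (rule summable_comparison_test'[where N=0])
qed

lemma entire_coeffs_scale: "entire_coeffs c \<Longrightarrow> entire_coeffs (\<lambda>n. a * c n)"
  unfolding entire_coeffs_def by (auto simp: abs_mult mult.assoc intro!: summable_mult)

lemma entire_coeffs_diffs:
  assumes "entire_coeffs c"
  shows "entire_coeffs (diffs c)"
  unfolding entire_coeffs_def
proof
  fix r
  have "summable (\<lambda>n. diffs (\<lambda>n. \<bar>c n\<bar>) n * r ^ n)"
    using assms by (intro termdiff_converges_all) (auto simp: entire_coeffs_def)
  then show "summable (\<lambda>n. \<bar>diffs c n\<bar> * r ^ n)" by (simp add: diffs_def abs_mult)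
qed

lemma pow_series_of_real: "entire_coeffs c \<Longrightarrow> pow_series c (of_real x) = of_real (pow_series c x)"
  using suminf_of_real[OF entire_coeffs_summable[of c x], symmetric] unfolding pow_series_def by simp

lemma pow_series_0: "pow_series c 0 = of_real (c 0)"
  by (simp add: pow_series_def powser_zero[where f="\<lambda>n. of_real (c n)"])

lemma pow_series_add:
  assumes "entire_coeffs c" "entire_coeffs d"
  shows "pow_series (\<lambda>n. c n + d n) z = pow_series c z + pow_series d z"
  using suminf_add[OF entire_coeffs_summable[OF assms(1), of z] entire_coeffs_summable[OF assms(2), of z]]
  by (simp add: pow_series_def distrib_right)

lemma pow_series_scale:
  assumes "entire_coeffs c"
  shows "pow_series (\<lambda>n. a * c n) z = of_real a * pow_series c z"
  using suminf_mult[OF entire_coeffs_summable[OF assms, of z], of "of_real a"]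
  by (simp add: pow_series_def mult.assoc)

lemma has_field_derivative_pow_series:
  fixes z :: "'a::{real_normed_field,banach}"
  assumes "entire_coeffs c"
  shows "(pow_series c has_field_derivative pow_series (diffs c) z) (at z)"
proof -
  have "((\<lambda>x. \<Sum>n. of_real (c n) * x ^ n) has_field_derivative
          (\<Sum>n. diffs (\<lambda>n. of_real (c n)) n * z ^ n)) (at z)"
    by (rule termdiffs_strong_converges_everywhere) (rule entire_coeffs_summable[OF assms])
  then show ?thesis by (simp add: pow_series_def[abs_def] diffs_def)
qed

lemma continuous_on_pow_series [continuous_intros]:
  assumes "entire_coeffs c" "continuous_on S f"
  shows "continuous_on S (\<lambda>x. pow_series c (f x :: 'a::{real_normed_field,banach}))"
proof -
  have "continuous_on UNIV (pow_series c :: 'a \<Rightarrow> 'a)"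
    using DERIV_isCont[OF has_field_derivative_pow_series[OF assms(1)]]
    by (intro continuous_at_imp_continuous_on) auto
  from continuous_on_compose2[OF this assms(2)] show ?thesis by simp
qed

text \<open>The Euler operator \<open>z d/dz\<close> acts diagonally on coefficients and therefore
  commutes with the approximation weights. This is why \<open>z h''\<close> is always handled as the
  series with coefficients \<open>n * c n\<close>.\<close>

lemma mult_pow_series_diffs:
  fixes z :: "'a::{real_normed_field,banach}"
  assumes "entire_coeffs c"
  shows "z * pow_series (diffs c) z = pow_series (\<lambda>n. real n * c n) z"
proof -
  have "pow_series (\<lambda>n. real n * c n) z = (\<Sum>n. of_real (real (Suc n) * c (Suc n)) * z ^ Suc n)"
    using suminf_split_head[OF entire_coeffs_summable[OF entire_coeffs_nat_mult[OF assms], of z]]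
    by (simp add: pow_series_def)
  also have "\<dots> = z * pow_series (diffs c) z"
    using suminf_mult[OF entire_coeffs_summable[OF entire_coeffs_diffs[OF assms], of z], of z]
    by (simp add: pow_series_def diffs_def mult_ac)
  finally show ?thesis ..
qed

section \<open>Approximation of the power series by polynomials\<close>

text \<open>For \<open>N > 0\<close> this is the product of the factors \<open>1 - i/N\<close> over
  \<open>i < n\<close>: it lies between 0 and 1, tends to 1, and vanishes for \<open>n > N\<close>,
  which truncates the series to a polynomial.\<close>

definition approx_weight :: "nat \<Rightarrow> nat \<Rightarrow> real" where
  "approx_weight N n = real (N choose n) * fact n / real N ^ n"

lemma approx_weight_bounds: "0 \<le> approx_weight N n" "approx_weight N n \<le> 1"
proof -
  have "real ((N choose n) * fact n) \<le> real (N ^ n)"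
    using binomial_fact_pow by (rule of_nat_mono)
  then show "approx_weight N n \<le> 1"
    by (cases "N = 0") (auto simp: approx_weight_def divide_le_eq_1)
qed (simp add: approx_weight_def)

lemma entire_coeffs_approx:
  assumes "entire_coeffs c"
  shows "entire_coeffs (\<lambda>n. approx_weight N n * c n)"
  using approx_weight_bounds[of N] by (intro entire_coeffs_mult_bounded assms) (simp add: abs_of_nonneg)

lemma tendsto_approx_weight: "(\<lambda>N. approx_weight N n) \<longlonglongrightarrow> 1"
proof -
  have "approx_weight N n = (\<Prod>i = 0..<n. (real N - real i) / real N)" for N
    using gbinomial_mult_fact'[of "real N" n]
    by (simp add: approx_weight_def binomial_gbinomial prod_dividef)
  moreover have "(\<lambda>N. \<Prod>i = 0..<n. (real N - real i) / real N) \<longlonglongrightarrow> (\<Prod>i = 0..<n. 1)"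
  proof (intro tendsto_prod)
    fix i
    have "(\<lambda>N. 1 - real i * inverse (real N)) \<longlonglongrightarrow> 1 - real i * 0"
      by (intro tendsto_intros LIMSEQ_inverse_real_of_nat lim_inverse_n)
    then have "(\<lambda>N. 1 - real i * inverse (real N)) \<longlonglongrightarrow> 1" by simp
    moreover have "\<forall>\<^sub>F N in sequentially. 1 - real i * inverse (real N) = (real N - real i) / real N"
      using eventually_gt_at_top[of 0] by eventually_elim (simp add: field_simps)
    ultimately show "(\<lambda>N. (real N - real i) / real N) \<longlonglongrightarrow> 1"
      by (rule Lim_transform_eventually)
  qed
  ultimately show ?thesis by simp
qed

text \<open>On the disc the error is at most the sum of \<open>a k N\<close>, which no longer
  depends on the point. Tannery's theorem, with the absolutely convergent series at the radius as
  majorant, sends this sum to 0.\<close>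

lemma uniform_limit_approx:
  assumes "entire_coeffs c"
  shows "uniform_limit (cball 0 r) (\<lambda>N z. pow_series (\<lambda>n. approx_weight N n * c n) z :: 'a::{real_normed_field,banach})
           (pow_series c) sequentially"
proof -
  define a where "a = (\<lambda>k N. \<bar>approx_weight N k - 1\<bar> * (\<bar>c k\<bar> * \<bar>r\<bar> ^ k))"
  have w: "\<bar>approx_weight N k - 1\<bar> \<le> 1" for N k
    using approx_weight_bounds[of N k] by auto
  have sum_c: "summable (\<lambda>k. \<bar>c k\<bar> * \<bar>r\<bar> ^ k)" using assms by (auto simp: entire_coeffs_def)
  have a_le: "norm (a k N) \<le> \<bar>c k\<bar> * \<bar>r\<bar> ^ k" for k N
    unfolding a_def by (auto simp: abs_mult intro!: mult_left_le_one_le w)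
  have sum_a: "summable (\<lambda>k. a k N)" for N
    using a_le by (intro summable_comparison_test'[OF sum_c, of 0]) auto
  have "(\<lambda>N. suminf (\<lambda>k. a k N)) \<longlonglongrightarrow> suminf (\<lambda>k. 0)"
  proof (rule tannerys_theorem[THEN conjunct2, THEN conjunct2])
    show "(\<lambda>N. a k N) \<longlonglongrightarrow> 0" for k
    proof -
      have "(\<lambda>N. a k N) \<longlonglongrightarrow> \<bar>1 - 1\<bar> * (\<bar>c k\<bar> * \<bar>r\<bar> ^ k)"
        unfolding a_def by (intro tendsto_intros tendsto_approx_weight)
      then show ?thesis by simp
    qed
    show "\<forall>\<^sub>F (k, n) in sequentially \<times>\<^sub>F sequentially. norm (a k n) \<le> \<bar>c k\<bar> * \<bar>r\<bar> ^ k"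
      using a_le by (auto intro!: always_eventually)
  qed (use sum_c in auto)
  then have lim: "(\<lambda>N. suminf (\<lambda>k. a k N)) \<longlonglongrightarrow> 0" by simp
  have le: "norm (pow_series (\<lambda>n. approx_weight N n * c n) z - pow_series c z) \<le> suminf (\<lambda>k. a k N)"
    if "z \<in> cball 0 r" for N and z :: 'a
  proof -
    have z: "norm z \<le> \<bar>r\<bar>" using that by auto
    from suminf_diff[OF entire_coeffs_summable[OF entire_coeffs_approx[OF assms, of N], of z] entire_coeffs_summable[OF assms, of z]]
    have eq: "pow_series (\<lambda>n. approx_weight N n * c n) z - pow_series c z =
        (\<Sum>n. of_real ((approx_weight N n - 1) * c n) * z ^ n)"
      by (simp add: pow_series_def algebra_simps)
    show ?thesis unfolding eq
    proof (rule norm_suminf_le[OF _ sum_a])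
      fix n
      show "norm (of_real ((approx_weight N n - 1) * c n) * z ^ n) \<le> a n N"
      proof -
        have "norm (of_real ((approx_weight N n - 1) * c n) * z ^ n) =
                (\<bar>approx_weight N n - 1\<bar> * \<bar>c n\<bar>) * norm z ^ n"
          by (simp only: norm_mult norm_power norm_of_real abs_mult)
        also have "\<dots> \<le> (\<bar>approx_weight N n - 1\<bar> * \<bar>c n\<bar>) * \<bar>r\<bar> ^ n"
          using z by (intro mult_left_mono power_mono) auto
        finally show ?thesis by (simp add: a_def mult.assoc)
      qed
    qed
  qed
  show ?thesis
    unfolding uniform_limit_iff
  proof (intro allI impI)
    fix e :: real assume "e > 0"
    with lim have "\<forall>\<^sub>F N in sequentially. suminf (\<lambda>k. a k N) < e" by (auto intro: order_tendstoD)
    then show "\<forall>\<^sub>F N in sequentially. \<forall>z\<in>cball 0 r.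
        dist (pow_series (\<lambda>n. approx_weight N n * c n) z :: 'a) (pow_series c z) < e"
      by eventually_elim (auto simp only: dist_norm intro: le_less_trans[OF le])
  qed
qed

lemma tendsto_approx:
  assumes "entire_coeffs c"
  shows "(\<lambda>N. pow_series (\<lambda>n. approx_weight N n * c n) z :: 'a::{real_normed_field,banach}) \<longlonglongrightarrow> pow_series c z"
  by (rule tendsto_uniform_limitI[OF uniform_limit_approx[OF assms, of "norm z"]]) simp

lemma pow_series_coeff_poly:
  fixes z :: "'a::{real_normed_field,banach}"
  shows "pow_series (\<lambda>n. coeff p n / s ^ n) z = poly (map_poly of_real p) (z / of_real s)"
proof -
  have "pow_series (\<lambda>n. coeff p n / s ^ n) z = (\<Sum>n\<le>degree p. of_real (coeff p n / s ^ n) * z ^ n)"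
    unfolding pow_series_def by (intro suminf_finite) (auto simp: coeff_eq_0)
  also have "\<dots> = poly (map_poly of_real p) (z / of_real s)"
    by (simp add: poly_altdef coeff_map_poly power_divide degree_map_poly)
  finally show ?thesis .
qed

section \<open>Logarithmic derivatives of products with real zeros\<close>

lemma pow_series_nat_mult_prod:
  fixes z :: complex
  assumes "entire_coeffs d" "\<And>z::complex. pow_series d z = (\<Prod>c\<in>C. 1 - of_real c * z)"
    and nz: "\<And>c. c \<in> C \<Longrightarrow> 1 - of_real c * z \<noteq> 0"
  shows "pow_series (\<lambda>n. real n * d n) z = - pow_series d z * (\<Sum>c\<in>C. of_real c * z / (1 - of_real c * z))"
proof -
  have "((\<lambda>z. \<Prod>c\<in>C. 1 - of_real c * z) has_field_derivative
          (\<Prod>c\<in>C. 1 - of_real c * z) * (\<Sum>c\<in>C. - of_real c / (1 - of_real c * z))) (at z)"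
    by (intro has_field_derivative_prod' nz) (auto intro!: derivative_eq_intros)
  moreover have "pow_series d = (\<lambda>z. \<Prod>c\<in>C. 1 - of_real c * z :: complex)" using assms(2) by auto
  ultimately have "pow_series (diffs d) z = pow_series d z * (\<Sum>c\<in>C. - of_real c / (1 - of_real c * z))"
    using DERIV_unique[OF has_field_derivative_pow_series[OF assms(1), of z]] by metis
  then have "pow_series (\<lambda>n. real n * d n) z = z * (pow_series d z * (\<Sum>c\<in>C. - of_real c / (1 - of_real c * z)))"
    by (simp flip: mult_pow_series_diffs[OF assms(1)])
  also have "\<dots> = pow_series d z * (\<Sum>c\<in>C. z * (- of_real c / (1 - of_real c * z)))"
    by (simp only: sum_distrib_left mult_ac)
  also have "\<dots> = - pow_series d z * (\<Sum>c\<in>C. of_real c * z / (1 - of_real c * z))"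
    by (simp add: sum_negf mult_ac)
  finally show ?thesis .
qed

lemma pow_series_prod_real:
  fixes x :: real
  assumes "entire_coeffs d" "\<And>z::complex. pow_series d z = (\<Prod>c\<in>C. 1 - of_real c * z)"
  shows "pow_series d x = (\<Prod>c\<in>C. 1 - c * x)"
    and "(\<And>c. c \<in> C \<Longrightarrow> 1 - c * x \<noteq> 0) \<Longrightarrow>
           pow_series (\<lambda>n. real n * d n) x = - pow_series d x * (\<Sum>c\<in>C. c * x / (1 - c * x))"
proof -
  have "complex_of_real (pow_series d x) = of_real (\<Prod>c\<in>C. 1 - c * x)"
    using assms(2)[of "of_real x"] by (simp add: pow_series_of_real[OF assms(1)])
  then show "pow_series d x = (\<Prod>c\<in>C. 1 - c * x)" by (simp only: of_real_eq_iff)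
  assume nz: "\<And>c. c \<in> C \<Longrightarrow> 1 - c * x \<noteq> 0"
  have nz': "1 - complex_of_real c * of_real x \<noteq> 0" if "c \<in> C" for c
  proof -
    have "1 - complex_of_real c * of_real x = of_real (1 - c * x)" by simp
    then show ?thesis using nz[OF that] by (metis of_real_eq_0_iff)
  qed
  have "complex_of_real (pow_series (\<lambda>n. real n * d n) x) = of_real (- pow_series d x * (\<Sum>c\<in>C. c * x / (1 - c * x)))"
    using pow_series_nat_mult_prod[OF assms nz']
    by (simp add: pow_series_of_real[OF assms(1)] pow_series_of_real[OF entire_coeffs_nat_mult[OF assms(1)]])
  then show "pow_series (\<lambda>n. real n * d n) x = - pow_series d x * (\<Sum>c\<in>C. c * x / (1 - c * x))"
    by (simp only: of_real_eq_iff)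
qed

lemma norm_one_minus_ge:
  fixes z :: complex
  assumes "0 \<le> c"
  shows "1 - c * norm z \<le> norm (1 - of_real c * z)"
  using norm_triangle_ineq2[of 1 "of_real c * z"] assms by (simp add: norm_mult)

text \<open>Positivity on the segment keeps every zero \<open>1 / c\<close> beyond
  \<open>|z|\<close>, so \<open>c |z| < 1\<close>. Then \<open>|1 - c z| \<ge> 1 - c |z|\<close>
  gives both bounds factor by factor and summand by summand. The second is a comparison of
  logarithmic derivatives, written without quotients so that it is stable under limits.\<close>

lemma log_deriv_bound_pos:
  fixes z :: complex
  assumes d: "entire_coeffs d" "\<And>z::complex. pow_series d z = (\<Prod>c\<in>C. 1 - of_real c * z)"
    and C: "finite C" "\<And>c. c \<in> C \<Longrightarrow> 0 < c"
    and pos: "\<And>x::real. 0 \<le> x \<Longrightarrow> x \<le> norm z \<Longrightarrow> 0 < pow_series d x"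
  shows "pow_series d (norm z) \<le> norm (pow_series d z)"
    and "norm (pow_series (\<lambda>n. real n * d n) z) * pow_series d (norm z) \<le>
           - pow_series (\<lambda>n. real n * d n) (norm z) * norm (pow_series d z)"
proof -
  define r where "r = norm z"
  have lt: "c * r < 1" if "c \<in> C" for c
  proof (rule ccontr)
    assume *: "\<not> c * r < 1"
    have "0 < pow_series d (1 / c)"
      using * C(2)[OF that] by (intro pos) (auto simp: r_def field_simps)
    moreover have "pow_series d (1 / c) = 0"
      unfolding pow_series_prod_real(1)[OF d] using C that
      by (intro prod_zero) (auto intro!: bexI[of _ c] simp: C(2)[THEN less_imp_neq, symmetric])
    ultimately show False by simp
  qed
  have le: "1 - c * r \<le> norm (1 - of_real c * z)" if "c \<in> C" for c
    using norm_one_minus_ge C(2)[OF that] unfolding r_def by (intro norm_one_minus_ge) simp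
  have nz: "1 - of_real c * z \<noteq> 0" "1 - c * r \<noteq> 0" if "c \<in> C" for c
    using le[OF that] lt[OF that] by auto
  show "pow_series d (norm z) \<le> norm (pow_series d z)"
    unfolding pow_series_prod_real(1)[OF d] d(2) prod_norm[symmetric] r_def[symmetric]
    using lt le by (intro prod_mono) (auto simp: less_imp_le)
  have "norm (\<Sum>c\<in>C. of_real c * z / (1 - of_real c * z)) \<le> (\<Sum>c\<in>C. c * r / (1 - c * r))"
  proof (rule sum_norm_le)
    fix c assume c: "c \<in> C"
    then show "norm (of_real c * z / (1 - of_real c * z)) \<le> c * r / (1 - c * r)"
      using le[OF c] lt[OF c] C(2)[OF c] unfolding norm_divide norm_mult r_def
      by (intro frac_le) auto
  qed
  moreover have "pow_series d r \<ge> 0" using pos[of r] by (simp add: r_def)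
  ultimately have "norm (pow_series d z) * norm (\<Sum>c\<in>C. of_real c * z / (1 - of_real c * z)) * pow_series d r \<le>
        norm (pow_series d z) * (\<Sum>c\<in>C. c * r / (1 - c * r)) * pow_series d r"
    by (intro mult_right_mono mult_left_mono) auto
  moreover have "pow_series (\<lambda>n. real n * d n) z = - pow_series d z * (\<Sum>c\<in>C. of_real c * z / (1 - of_real c * z))"
    using nz(1) by (rule pow_series_nat_mult_prod[OF d])
  moreover have "pow_series (\<lambda>n. real n * d n) r = - pow_series d r * (\<Sum>c\<in>C. c * r / (1 - c * r))"
    using nz(2) by (rule pow_series_prod_real(2)[OF d])
  ultimately show "norm (pow_series (\<lambda>n. real n * d n) z) * pow_series d (norm z) \<le>
           - pow_series (\<lambda>n. real n * d n) (norm z) * norm (pow_series d z)"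
    unfolding r_def[symmetric] by (simp add: norm_mult mult_ac)
qed

text \<open>On a fixed circle the squared modulus is a quadratic polynomial in
  \<open>x = Re z\<close>. Its difference from the value at \<open>x = -r\<close> contains the
  factor \<open>x + r\<close>; the cofactor is nonnegative because \<open>c \<le> a\<close> and
  \<open>(a r)(c r) \<le> 1\<close>.\<close>

lemma norm_mixed_factors_ge:
  fixes z :: complex
  assumes "0 \<le> c" "c \<le> a" "a * norm z < 1"
  shows "(1 - a * norm z) * (1 + c * norm z) \<le> norm ((1 + of_real a * z) * (1 - of_real c * z))"
proof -
  define r x where "r = norm z" and "x = Re z"
  have sq: "(cmod (1 + of_real t * z))\<^sup>2 = 1 + 2 * t * x + t\<^sup>2 * r\<^sup>2" for t
    unfolding r_def x_def cmod_power2 by (simp add: power2_eq_square algebra_simps)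
  have x: "- r \<le> x" "x \<le> r"
    using abs_Re_le_cmod[of z] by (auto simp: r_def x_def)
  have r0: "r \<ge> 0" by (simp add: r_def)
  have "c * r \<le> a * r" using assms r0 by (intro mult_right_mono) auto
  then have "(a * r) * (c * r) \<le> 1 * 1" using assms r0 by (intro mult_mono) (auto simp: r_def)
  then have "0 \<le> 2 * (a - c) * (1 - (a * r) * (c * r))" "0 \<le> 4 * a * c * (r - x)" "0 \<le> x + r"
    using x assms by simp_all
  then have "0 \<le> (x + r) * (2 * (a - c) * (1 - (a * r) * (c * r)) + 4 * a * c * (r - x))"
    by (metis mult_nonneg_nonneg add_nonneg_nonneg)
  also have "\<dots> = (1 + 2 * a * x + a\<^sup>2 * r\<^sup>2) * (1 + 2 * (- c) * x + (- c)\<^sup>2 * r\<^sup>2) - ((1 - a * r) * (1 + c * r))\<^sup>2"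
    by (simp add: power2_eq_square algebra_simps)
  also have "\<dots> = (norm ((1 + of_real a * z) * (1 - of_real c * z)))\<^sup>2 - ((1 - a * r) * (1 + c * r))\<^sup>2"
    using sq[of a] sq[of "- c"] by (simp add: norm_mult power_mult_distrib)
  finally have "((1 - a * r) * (1 + c * r))\<^sup>2 \<le> (norm ((1 + of_real a * z) * (1 - of_real c * z)))\<^sup>2"
    by simp
  then show ?thesis unfolding r_def by (rule power2_le_imp_le) simp
qed

text \<open>Since \<open>a\<close> dominates the sum of the \<open>c\<close>, every summand \<open>c z / (1 - c z)\<close> of the logarithmic
  derivative can be paired with a part of \<open>a z / (1 + a z)\<close>; each pair attains its largest
  modulus at \<open>-\<bar>z\<bar>\<close>.\<close>

lemma log_deriv_pairing:
  fixes z :: "'a::field"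
  assumes "1 + a * z \<noteq> 0" "\<And>c. c \<in> C \<Longrightarrow> 1 - c * z \<noteq> 0"
  shows "a * z / (1 + a * z) - (\<Sum>c\<in>C. c * z / (1 - c * z)) =
    (a - sum (\<lambda>c. c) C) * z / (1 + a * z) - (\<Sum>c\<in>C. c * (a + c) * z\<^sup>2 / ((1 + a * z) * (1 - c * z)))"
proof -
  have "c * z / (1 - c * z) = c * z / (1 + a * z) + c * (a + c) * z\<^sup>2 / ((1 + a * z) * (1 - c * z))"
    if "c \<in> C" for c
  proof -
    have eq: "c * z = (c * z * (1 - c * z) + c * (a + c) * z\<^sup>2) / (1 + a * z)"
      using assms(1) by (simp add: nonzero_eq_divide_eq power2_eq_square algebra_simps)
    have "c * z / (1 - c * z) = (c * z * (1 - c * z) + c * (a + c) * z\<^sup>2) / ((1 + a * z) * (1 - c * z))"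
      by (subst (1) eq) simp
    then show ?thesis using assms(2)[OF that] by (simp add: add_divide_distrib)
  qed
  then have "(\<Sum>c\<in>C. c * z / (1 - c * z)) =
      (\<Sum>c\<in>C. c * z / (1 + a * z) + c * (a + c) * z\<^sup>2 / ((1 + a * z) * (1 - c * z)))"
    by (intro sum.cong) auto
  also have "\<dots> = sum (\<lambda>c. c) C * z / (1 + a * z)
      + (\<Sum>c\<in>C. c * (a + c) * z\<^sup>2 / ((1 + a * z) * (1 - c * z)))"
    by (simp add: sum.distrib sum_distrib_right sum_divide_distrib)
  finally show ?thesis by (simp add: left_diff_distrib diff_divide_distrib)
qed

text \<open>Each \<open>c\<close> is at most the sum and hence at most \<open>a\<close>, so the
  single condition on \<open>a |z|\<close> controls all factors. The lower bound involves only
  \<open>a\<close>, not the number of factors, which allows it to be made uniform in the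
  degree.\<close>

lemma log_deriv_bound_neg:
  fixes z :: complex
  assumes d: "entire_coeffs d" "\<And>z::complex. pow_series d z = (\<Prod>c\<in>insert (-a) C. 1 - of_real c * z)"
    and C: "finite C" "\<And>c. c \<in> C \<Longrightarrow> 0 < c" and a: "a > 0" "sum (\<lambda>c. c) C \<le> a"
    and r: "a * norm z < 1"
  shows "(1 - a * norm z)\<^sup>2 \<le> norm (pow_series d z)"
    and "norm (pow_series (\<lambda>n. real n * d n) z) * pow_series d (- norm z) \<le>
           - pow_series (\<lambda>n. real n * d n) (- norm z) * norm (pow_series d z)"
proof -
  define r where "r = norm z"
  have r0: "r \<ge> 0" and ar: "a * r < 1" using assms by (auto simp: r_def)
  have ca: "c \<le> a" if "c \<in> C" for c
    using member_le_sum[of c C "\<lambda>c. c"] that C a by (auto simp: less_imp_le)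
  have cr: "c * r < 1" if "c \<in> C" for c
    using mult_right_mono[OF ca[OF that] r0] ar by linarith
  have anC: "- a \<notin> C" using C(2)[of "-a"] a by auto
  have le: "1 - c * r \<le> norm (1 - of_real c * z)" if "c \<in> C" for c
    unfolding r_def using C(2)[OF that] by (intro norm_one_minus_ge) simp
  have lea: "1 - a * r \<le> norm (1 + of_real a * z)"
    using norm_one_minus_ge[of a "- z"] a by (simp add: r_def)
  have nza: "1 + of_real a * z \<noteq> 0" using lea ar by auto
  have nzc: "1 - of_real c * z \<noteq> 0" if "c \<in> C" for c using le[OF that] cr[OF that] by auto
  have nzc': "1 + c * r > 0" if "c \<in> C" for c using C(2)[OF that] r0
    by (intro add_pos_nonneg) auto

  \<comment> \<open>The Weierstrass product inequality bounds the product over \<open>C\<close>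
    below by one minus the sum, so the dominance of \<open>a\<close> makes \<open>1 - a r\<close> a
    lower bound for both parts of the product.\<close>
  have "1 - a * r \<le> 1 - sum (\<lambda>c. c) C * r"
    using mult_right_mono[OF a(2) r0] by simp
  also have "\<dots> \<le> (\<Prod>c\<in>C. 1 - c * r)"
    unfolding sum_distrib_right using C(2) cr r0
    by (intro Weierstrass_prod_ineq) (auto simp: less_imp_le)
  also have "\<dots> \<le> (\<Prod>c\<in>C. norm (1 - of_real c * z))"
    using le cr by (intro prod_mono) (auto simp: less_imp_le)
  finally have "1 - a * r \<le> norm (\<Prod>c\<in>C. 1 - of_real c * z)" by (simp add: prod_norm)
  then have "(1 - a * r) * (1 - a * r) \<le> norm (1 + of_real a * z) * norm (\<Prod>c\<in>C. 1 - of_real c * z)"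
    using lea ar by (intro mult_mono) auto
  then show "(1 - a * norm z)\<^sup>2 \<le> norm (pow_series d z)"
    using C anC unfolding d(2) by (simp add: norm_mult power2_eq_square r_def)

  \<comment> \<open>This is the paired form of the sum at the point \<open>-r\<close>, where every
    term is nonnegative; it majorises the moduli of the terms at \<open>z\<close>.\<close>
  define S where "S = (a - sum (\<lambda>c. c) C) * r / (1 - a * r)
      + (\<Sum>c\<in>C. c * (a + c) * r\<^sup>2 / ((1 - a * r) * (1 + c * r)))"
  have "(\<Sum>c\<in>insert (-a) C. of_real c * z / (1 - of_real c * z)) =
      - (of_real a * z / (1 + of_real a * z) - (\<Sum>c\<in>C. of_real c * z / (1 - of_real c * z)))"
    using C anC by simp
  also have "\<dots> = - ((of_real a - (\<Sum>c\<in>C. of_real c)) * z / (1 + of_real a * z)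
      - (\<Sum>c\<in>C. of_real c * (of_real a + of_real c) * z\<^sup>2 / ((1 + of_real a * z) * (1 - of_real c * z))))"
  proof -
    \<comment> \<open>The pairing identity is stated over one field, so the real set is first
      embedded into the complex numbers.\<close>
    have inj: "inj_on complex_of_real C" by (simp add: inj_on_def)
    have "1 - c * z \<noteq> 0" if "c \<in> complex_of_real ` C" for c using nzc that by auto
    from log_deriv_pairing[OF nza, of "complex_of_real ` C", OF this] show ?thesis
      by (simp add: sum.reindex[OF inj] o_def ball_simps)
  qed
  finally have sum1: "(\<Sum>c\<in>insert (-a) C. of_real c * z / (1 - of_real c * z)) = \<dots>" .
  have sum2: "(\<Sum>c\<in>insert (-a) C. c * (- r) / (1 - c * (- r))) = S"
  proof -
    have "(\<Sum>c\<in>insert (-a) C. c * (- r) / (1 - c * (- r))) =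
      - (a * (- r) / (1 + a * (- r)) - (\<Sum>c\<in>C. c * (- r) / (1 - c * (- r))))"
      using C anC by simp
    also have "\<dots> = S"
      using ar nzc' by (subst log_deriv_pairing) (auto simp: S_def less_imp_neq[symmetric])
    finally show ?thesis .
  qed
  have "norm (\<Sum>c\<in>insert (-a) C. of_real c * z / (1 - of_real c * z)) \<le> S"
    unfolding sum1 norm_minus_cancel S_def
  proof (rule order_trans[OF norm_triangle_ineq4] add_mono)+
    have "complex_of_real a - (\<Sum>c\<in>C. of_real c) = of_real (a - sum (\<lambda>c. c) C)" by simp
    then have "norm (complex_of_real a - (\<Sum>c\<in>C. of_real c)) = a - sum (\<lambda>c. c) C"
      using a by (simp only: norm_of_real abs_of_nonneg diff_ge_0_iff_ge)
    then show "norm ((complex_of_real a - (\<Sum>c\<in>C. of_real c)) * z / (1 + of_real a * z)) \<le>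
        (a - sum (\<lambda>c. c) C) * r / (1 - a * r)"
      unfolding norm_divide norm_mult r_def[symmetric] using lea ar a r0
      by (auto intro!: frac_le)
    show "norm (\<Sum>c\<in>C. complex_of_real c * (of_real a + of_real c) * z\<^sup>2 / ((1 + of_real a * z) * (1 - of_real c * z)))
      \<le> (\<Sum>c\<in>C. c * (a + c) * r\<^sup>2 / ((1 - a * r) * (1 + c * r)))"
    proof (rule sum_norm_le)
      fix c assume c: "c \<in> C"
      have "norm (complex_of_real a + of_real c) = a + c"
        using a C(2)[OF c] by (simp flip: of_real_add)
      then have n: "norm (complex_of_real c * (of_real a + of_real c) * z\<^sup>2) = c * (a + c) * r\<^sup>2"
        using C(2)[OF c] by (simp add: norm_mult norm_power r_def)
      show "norm (complex_of_real c * (of_real a + of_real c) * z\<^sup>2 / ((1 + of_real a * z) * (1 - of_real c * z)))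
          \<le> c * (a + c) * r\<^sup>2 / ((1 - a * r) * (1 + c * r))"
        unfolding norm_divide n
        using norm_mixed_factors_ge[of c a z] C(2)[OF c] ca[OF c] ar a nzc'[OF c] r0
        by (intro frac_le mult_pos_pos) (auto simp: r_def)
    qed
  qed
  moreover have pos: "pow_series d (- r) \<ge> 0"
    unfolding pow_series_prod_real(1)[OF d] using C anC ar nzc'
    by (auto intro!: mult_nonneg_nonneg prod_nonneg simp: less_imp_le)
  ultimately have "norm (pow_series d z) * norm (\<Sum>c\<in>insert (-a) C. of_real c * z / (1 - of_real c * z)) * pow_series d (- r)
      \<le> norm (pow_series d z) * S * pow_series d (- r)"
    by (intro mult_right_mono mult_left_mono) auto
  moreover have "pow_series (\<lambda>n. real n * d n) z = - pow_series d z * (\<Sum>c\<in>insert (-a) C. of_real c * z / (1 - of_real c * z))"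
  proof (rule pow_series_nat_mult_prod[OF d])
    fix c assume c: "c \<in> insert (- a) C"
    have "1 - of_real (- a) * z = 1 + of_real a * z" by simp
    then show "1 - of_real c * z \<noteq> 0" using nza nzc c by (metis insertE)
  qed
  moreover have "pow_series (\<lambda>n. real n * d n) (- r) = - pow_series d (- r) * S"
    unfolding sum2[symmetric] using ar nzc'
    by (intro pow_series_prod_real(2)[OF d]) (auto simp: less_imp_neq[symmetric])
  ultimately show "norm (pow_series (\<lambda>n. real n * d n) z) * pow_series d (- norm z) \<le>
           - pow_series (\<lambda>n. real n * d n) (- norm z) * norm (pow_series d z)"
    unfolding r_def[symmetric] by (simp add: norm_mult mult_ac)
qed

section \<open>Bessel functions as power series\<close>

text \<open>
  Taylor coefficients of \<open>h\<^sub>\<nu>(z) / z\<close> and of \<open>h\<^sub>\<nu>'(z)\<close>; up to the factor \<open>(z/2)\<^sup>\<nu> / \<Gamma>(\<nu> + 1)\<close>, the first series at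
  \<open>z\<^sup>2\<close> is \<open>J\<^sub>\<nu>(z)\<close>.
\<close>

definition bessel_coeff :: "real \<Rightarrow> nat \<Rightarrow> real" where
  "bessel_coeff \<nu> n = (-1/4) ^ n / (fact n * pochhammer (\<nu> + 1) n)"

definition dh_coeff :: "real \<Rightarrow> nat \<Rightarrow> real" where
  "dh_coeff \<nu> n = (real n + 1) * bessel_coeff \<nu> n"

text \<open>The range \<nu> > -2 with \<nu> different from -1 covers both parts of the theorem and
  keeps \<open>\<nu> + 1\<close> away from the nonpositive integers.\<close>

lemma pochhammer_nonzero:
  fixes \<nu> :: real
  assumes "\<nu> > -2" "\<nu> \<noteq> -1"
  shows "pochhammer (\<nu> + 1) n \<noteq> 0"
proof
  assume "pochhammer (\<nu> + 1) n = 0"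
  then obtain k where "k < n" "\<nu> + 1 = - real k" by (auto simp: pochhammer_eq_0_iff)
  with assms show False by (cases k) auto
qed

text \<open>Bessel's differential equation in coefficient form.\<close>

lemma bessel_coeff_Suc:
  assumes "\<nu> > -2" "\<nu> \<noteq> -1"
  shows "(real n + 1) * (real n + 1 + \<nu>) * bessel_coeff \<nu> (Suc n) = - bessel_coeff \<nu> n / 4"
proof -
  have "real n + 1 + \<nu> \<noteq> 0" using assms by (cases n) auto
  then have nz: "\<nu> + 1 + real n \<noteq> 0" "real n + 1 \<noteq> 0" by auto
  have "bessel_coeff \<nu> (Suc n) = - bessel_coeff \<nu> n / 4 / ((real n + 1) * (\<nu> + 1 + real n))"
    by (simp add: bessel_coeff_def pochhammer_rec' mult_ac add_ac)
  then show ?thesis using nz by (simp add: add_ac)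
qed

lemma entire_bessel_coeff:
  assumes "\<nu> > -2" "\<nu> \<noteq> -1"
  shows "entire_coeffs (bessel_coeff \<nu>)"
  unfolding entire_coeffs_def
proof
  fix r :: real
  \<comment> \<open>Chosen so that
    \<open>|r| \<le> n (\<nu> + 2) \<le> (n + 1)(n + 1 + \<nu>)\<close> from \<open>N\<close> on;
    the recurrence then gives the ratio 1/4.\<close>
  define N where "N = nat \<lceil>\<bar>r\<bar> / (\<nu> + 2)\<rceil> + 1"
  show "summable (\<lambda>n. \<bar>bessel_coeff \<nu> n\<bar> * r ^ n)"
  proof (rule summable_ratio_test)
    fix n assume n: "N \<le> n"
    have "\<bar>r\<bar> / (\<nu> + 2) \<le> real n" using n unfolding N_def by linarith
    then have r: "\<bar>r\<bar> \<le> real n * (\<nu> + 2)" using assms by (simp add: field_simps)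
    have "real n \<ge> 1" using n by (simp add: N_def)
    then have p: "real n + 1 + \<nu> \<ge> \<nu> + 2" "\<nu> + 2 > 0" using assms by auto
    have "\<bar>r\<bar> \<le> (real n + 1) * (real n + 1 + \<nu>)"
      using p by (intro order_trans[OF r] mult_mono) auto
    then have "\<bar>bessel_coeff \<nu> (Suc n)\<bar> * \<bar>r\<bar> \<le> \<bar>bessel_coeff \<nu> (Suc n)\<bar> * ((real n + 1) * (real n + 1 + \<nu>))"
      by (intro mult_left_mono) auto
    also have "\<dots> = \<bar>(real n + 1) * (real n + 1 + \<nu>) * bessel_coeff \<nu> (Suc n)\<bar>"
      using p by (simp add: abs_mult)
    also have "\<dots> = \<bar>bessel_coeff \<nu> n\<bar> / 4" unfolding bessel_coeff_Suc[OF assms] by simp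
    finally have "\<bar>bessel_coeff \<nu> (Suc n)\<bar> * \<bar>r\<bar> * \<bar>r\<bar> ^ n \<le> \<bar>bessel_coeff \<nu> n\<bar> / 4 * \<bar>r\<bar> ^ n"
      by (intro mult_right_mono) auto
    then show "norm (\<bar>bessel_coeff \<nu> (Suc n)\<bar> * r ^ Suc n) \<le> 1/4 * norm (\<bar>bessel_coeff \<nu> n\<bar> * r ^ n)"
      by (simp add: abs_mult power_abs mult_ac)
  qed auto
qed

lemma entire_dh_coeff:
  assumes "\<nu> > -2" "\<nu> \<noteq> -1"
  shows "entire_coeffs (dh_coeff \<nu>)"
  unfolding dh_coeff_def[abs_def] by (intro entire_coeffs_Suc_mult entire_bessel_coeff assms)

lemma pow_series_dh_coeff:
  fixes z :: "'a::{real_normed_field,banach}"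
  assumes "\<nu> > -2" "\<nu> \<noteq> -1"
  shows "pow_series (dh_coeff \<nu>) z = pow_series (bessel_coeff \<nu>) z + z * pow_series (diffs (bessel_coeff \<nu>)) z"
proof -
  note e = entire_bessel_coeff[OF assms]
  have "dh_coeff \<nu> = (\<lambda>n. bessel_coeff \<nu> n + real n * bessel_coeff \<nu> n)"
    by (auto simp: dh_coeff_def algebra_simps)
  then show ?thesis by (simp add: pow_series_add[OF e entire_coeffs_nat_mult[OF e]] mult_pow_series_diffs[OF e])
qed

text \<open>With \<open>h = z g\<close>, Bessel's equation removes the second derivative of
  \<open>g\<close>, leaving \<open>z h''\<close> as a combination of \<open>g\<close> and
  \<open>g'\<close>, that is, of the orders \<nu> and \<nu> + 1.\<close>

lemma pow_series_nat_dh_coeff: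
  fixes z :: "'a::{real_normed_field,banach}"
  assumes "\<nu> > -2" "\<nu> \<noteq> -1"
  shows "pow_series (\<lambda>n. real n * dh_coeff \<nu> n) z =
    of_real (1 - \<nu>) * (z * pow_series (diffs (bessel_coeff \<nu>)) z) - z / 4 * pow_series (bessel_coeff \<nu>) z"
proof -
  note e = entire_bessel_coeff[OF assms]
  note en = entire_coeffs_nat_mult[OF e]
  \<comment> \<open>The coefficients of \<open>z g' + \<nu> g\<close>; by Bessel's equation the
    derivative of this function is \<open>-g / 4\<close>.\<close>
  define c where "c = (\<lambda>n. real n * bessel_coeff \<nu> n + \<nu> * bessel_coeff \<nu> n)"
  have ec: "entire_coeffs c" unfolding c_def by (intro entire_coeffs_add en entire_coeffs_scale e)
  have "diffs c = (\<lambda>n. (-1/4) * bessel_coeff \<nu> n)"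
  proof
    fix n show "diffs c n = (-1/4) * bessel_coeff \<nu> n"
      using bessel_coeff_Suc[OF assms, of n] by (simp add: diffs_def c_def algebra_simps)
  qed
  then have "pow_series (\<lambda>n. real n * c n) z = - (z / 4) * pow_series (bessel_coeff \<nu>) z"
    unfolding mult_pow_series_diffs[OF ec, symmetric] using pow_series_scale[OF e, of "-1/4" z] by simp
  moreover have "(\<lambda>n. real n * dh_coeff \<nu> n) =
      (\<lambda>n. real n * c n + (1 - \<nu>) * (real n * bessel_coeff \<nu> n))"
    by (auto simp: c_def dh_coeff_def algebra_simps)
  ultimately show ?thesis
    using pow_series_add[OF entire_coeffs_nat_mult[OF ec] entire_coeffs_scale[OF en, of "1 - \<nu>"], of z]
      pow_series_scale[OF en, of "1 - \<nu>" z] by (simp add: mult_pow_series_diffs[OF e])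
qed

text \<open>Series form of the classical relation that the derivative of
  \<open>J_\<nu>(x) / x^\<nu>\<close> is \<open>-J_(\<nu>+1)(x) / x^\<nu>\<close>.\<close>

lemma pow_series_bessel_coeff_succ:
  fixes z :: "'a::{real_normed_field,banach}"
  assumes "\<nu> > -2" "\<nu> \<noteq> -1"
  shows "pow_series (bessel_coeff (\<nu> + 1)) z = - of_real (4 * (\<nu> + 1)) * pow_series (diffs (bessel_coeff \<nu>)) z"
proof -
  have "bessel_coeff (\<nu> + 1) = (\<lambda>n. - (4 * (\<nu> + 1)) * diffs (bessel_coeff \<nu>) n)"
  proof
    fix n
    have "\<nu> + 1 \<noteq> 0" using assms by simp
    then show "bessel_coeff (\<nu> + 1) n = - (4 * (\<nu> + 1)) * diffs (bessel_coeff \<nu>) n"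
      by (simp add: diffs_def bessel_coeff_def pochhammer_rec divide_simps del: of_nat_Suc)
        (simp add: algebra_simps)
  qed
  then show ?thesis
    using pow_series_scale[OF entire_coeffs_diffs[OF entire_bessel_coeff[OF assms]], of "- (4 * (\<nu> + 1))" z] by simp
qed

lemma rGamma_nonzero:
  assumes "\<nu> > -2" "\<nu> \<noteq> (-1::real)"
  shows "rGamma (\<nu> + 1) \<noteq> 0"
proof
  assume "rGamma (\<nu> + 1) = 0"
  then obtain n where "\<nu> + 1 = - real n" by (auto simp: rGamma_eq_zero_iff elim!: nonpos_Ints_cases')
  with assms show False by (cases n) auto
qed

lemma rGamma_shift:
  assumes "\<nu> > -2" "\<nu> \<noteq> (-1::real)"
  shows "rGamma (real n + \<nu> + 1) = rGamma (\<nu> + 1) / pochhammer (\<nu> + 1) n"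
  using pochhammer_rGamma[of "\<nu> + 1" n] pochhammer_nonzero[OF assms, of n]
  by (simp add: add_ac)

lemma bessel_J_eq:
  assumes "\<nu> > -2" "\<nu> \<noteq> -1"
  shows "bessel_J \<nu> z = of_real (rGamma (\<nu> + 1)) * bessel_pow \<nu> (z / 2) * pow_series (bessel_coeff \<nu>) (z\<^sup>2)"
proof -
  have "bessel_J \<nu> z = (\<Sum>n. (of_real (rGamma (\<nu> + 1)) * bessel_pow \<nu> (z / 2)) *
          (of_real (bessel_coeff \<nu> n) * (z\<^sup>2) ^ n))"
    unfolding bessel_J_def
  proof (intro suminf_cong)
    fix n
    have "(z / 2) ^ (2 * n) = (z\<^sup>2) ^ n / 4 ^ n" by (simp add: power_mult power_divide)
    moreover have "(-1 / 4 :: complex) ^ n = (-1) ^ n / 4 ^ n" by (rule power_divide)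
    ultimately show "(-1) ^ n / fact n * complex_of_real (rGamma (real n + \<nu> + 1)) *
        ((z / 2) ^ (2 * n) * bessel_pow \<nu> (z / 2)) =
      of_real (rGamma (\<nu> + 1)) * bessel_pow \<nu> (z / 2) * (of_real (bessel_coeff \<nu> n) * (z\<^sup>2) ^ n)"
      by (simp add: rGamma_shift[OF assms] bessel_coeff_def mult_ac)
  qed
  also have "\<dots> = of_real (rGamma (\<nu> + 1)) * bessel_pow \<nu> (z / 2) * pow_series (bessel_coeff \<nu>) (z\<^sup>2)"
    unfolding pow_series_def by (rule suminf_mult[OF entire_coeffs_summable[OF entire_bessel_coeff[OF assms]]])
  finally show ?thesis .
qed

text \<open>Compared with \<open>bessel_J\<close> only the sign of the argument of the series
  changes, so both equations for the radius concern one entire function, on opposite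
  half-axes.\<close>

lemma bessel_I_eq:
  assumes "\<nu> > -2" "\<nu> \<noteq> -1"
  shows "bessel_I \<nu> z = of_real (rGamma (\<nu> + 1)) * bessel_pow \<nu> (z / 2) * pow_series (bessel_coeff \<nu>) (- z\<^sup>2)"
proof -
  have "bessel_I \<nu> z = (\<Sum>n. (of_real (rGamma (\<nu> + 1)) * bessel_pow \<nu> (z / 2)) *
          (of_real (bessel_coeff \<nu> n) * (- z\<^sup>2) ^ n))"
    unfolding bessel_I_def
  proof (intro suminf_cong)
    fix n
    have "(z / 2) ^ (2 * n) = (z\<^sup>2) ^ n / 4 ^ n" by (simp add: power_mult power_divide)
    moreover have "(-1 / 4 :: complex) ^ n * (- z\<^sup>2) ^ n = (z\<^sup>2) ^ n / 4 ^ n"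
      by (simp flip: power_mult_distrib power_divide)
    ultimately show "1 / fact n * complex_of_real (rGamma (real n + \<nu> + 1)) *
        ((z / 2) ^ (2 * n) * bessel_pow \<nu> (z / 2)) =
      of_real (rGamma (\<nu> + 1)) * bessel_pow \<nu> (z / 2) * (of_real (bessel_coeff \<nu> n) * (- z\<^sup>2) ^ n)"
      by (simp add: rGamma_shift[OF assms] bessel_coeff_def mult_ac)
  qed
  also have "\<dots> = of_real (rGamma (\<nu> + 1)) * bessel_pow \<nu> (z / 2) * pow_series (bessel_coeff \<nu>) (- z\<^sup>2)"
    unfolding pow_series_def by (rule suminf_mult[OF entire_coeffs_summable[OF entire_bessel_coeff[OF assms]]])
  finally show ?thesis .
qed

lemma bessel_pow_nonzero: "w \<noteq> 0 \<Longrightarrow> bessel_pow \<nu> w \<noteq> 0"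
  by (simp add: bessel_pow_def)

lemma bessel_pow_add_1:
  assumes "w \<noteq> 0" "\<nu> \<noteq> -1"
  shows "bessel_pow (\<nu> + 1) w = w * bessel_pow \<nu> w"
  using assms by (simp add: bessel_pow_def powr_add)

text \<open>The imaginary part of \<open>Ln z / 2\<close> lies within half the principal strip, so
  \<open>Ln (csqrt z / 2)\<close> is exactly \<open>Ln z / 2 - ln 2\<close>, even on the cut. The
  two complex powers therefore combine to \<open>z\<close> without a jump.\<close>

lemma bessel_h_eq:
  assumes "\<nu> > -2" "\<nu> \<noteq> -1"
  shows "bessel_h \<nu> z = z * pow_series (bessel_coeff \<nu>) z"
proof (cases "z = 0")
  case False
  define K where "K = of_real (2 powr \<nu>) * (z powr of_real (1 - \<nu> / 2) * bessel_pow \<nu> (csqrt z / 2))"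
  have "of_real (Gamma (\<nu> + 1)) * of_real (rGamma (\<nu> + 1)) = (1 :: complex)"
    using rGamma_nonzero[OF assms] by (simp add: Gamma_def flip: of_real_mult)
  then have "bessel_h \<nu> z = K * pow_series (bessel_coeff \<nu>) z"
    unfolding bessel_h_def K_def by (simp add: bessel_J_eq[OF assms])
  moreover have "K = z"
  proof (cases "\<nu> = 0")
    case True
    then show ?thesis using False by (simp add: K_def bessel_pow_def)
  next
    case \<nu>: False
    have "csqrt z / 2 = exp (Ln z / 2 - of_real (ln 2))"
      using False by (simp add: csqrt_exp_Ln exp_diff exp_of_real)
    moreover have "Ln (exp (Ln z / 2 - of_real (ln 2))) = Ln z / 2 - of_real (ln 2)"
      using mpi_less_Im_Ln[OF False] Im_Ln_le_pi[OF False] pi_gt_zero by (intro Ln_exp) auto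
    ultimately have "Ln (csqrt z / 2) = Ln z / 2 - of_real (ln 2)" by simp
    then have "K = exp (of_real (\<nu> * ln 2)) * (exp (of_real (1 - \<nu> / 2) * Ln z) * exp (of_real \<nu> * (Ln z / 2 - of_real (ln 2))))"
      using False \<nu> exp_of_real[of "\<nu> * ln 2", where 'a=complex] by (simp add: K_def bessel_pow_def powr_def)
    also have "\<dots> = exp (Ln z)"
      by (simp add: algebra_simps flip: exp_add)
    finally show ?thesis using False by simp
  qed
  ultimately show ?thesis by simp
qed (simp add: bessel_h_def)

lemma has_field_derivative_bessel_h:
  assumes "\<nu> > -2" "\<nu> \<noteq> -1"
  shows "(bessel_h \<nu> has_field_derivative pow_series (dh_coeff \<nu>) z) (at z)"
proof -
  have "((\<lambda>z. z * pow_series (bessel_coeff \<nu>) z) has_field_derivative pow_series (dh_coeff \<nu>) z) (at z)"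
    by (auto intro!: derivative_eq_intros has_field_derivative_pow_series entire_bessel_coeff assms
        simp: pow_series_dh_coeff[OF assms])
  then show ?thesis using bessel_h_eq[OF assms] by presburger
qed

lemma deriv_bessel_h:
  assumes "\<nu> > -2" "\<nu> \<noteq> -1"
  shows "deriv (bessel_h \<nu>) = pow_series (dh_coeff \<nu>)"
    and "z * deriv (deriv (bessel_h \<nu>)) z = pow_series (\<lambda>n. real n * dh_coeff \<nu> n) z"
proof -
  show *: "deriv (bessel_h \<nu>) = pow_series (dh_coeff \<nu>)"
    using has_field_derivative_bessel_h[OF assms] by (auto intro: DERIV_imp_deriv)
  show "z * deriv (deriv (bessel_h \<nu>)) z = pow_series (\<lambda>n. real n * dh_coeff \<nu> n) z"
    unfolding * mult_pow_series_diffs[OF entire_dh_coeff[OF assms], symmetric]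
    by (subst DERIV_imp_deriv[OF has_field_derivative_pow_series[OF entire_dh_coeff[OF assms]]]) simp
qed

lemma conv_radius_bessel_h:
  assumes "\<nu> > -2" "\<nu> \<noteq> -1"
  shows "fps_conv_radius (fps_expansion (bessel_h \<nu>) 0) = \<infinity>"
proof -
  have "bessel_h \<nu> holomorphic_on eball 0 \<infinity>"
    using has_field_derivative_bessel_h[OF assms]
    by (auto simp: holomorphic_on_def field_differentiable_def intro: has_field_derivative_at_within)
  from conv_radius_fps_expansion[OF this] show ?thesis by simp
qed

text \<open>Differentiating the power contributes \<nu> times \<open>J\<close>, which cancels the
  \<nu> in \<open>2 - \<nu>\<close>. What remains is twice \<open>h'\<close> at the square of
  \<open>z\<close>, so the Dini zeros off the cut are square roots of zeros of
  \<open>h'\<close>.\<close>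

lemma dini_eq:
  assumes "\<nu> > -2" "\<nu> \<noteq> -1" "z \<notin> \<real>\<^sub>\<le>\<^sub>0"
  shows "dini \<nu> z = 2 * of_real (rGamma (\<nu> + 1)) * bessel_pow \<nu> (z / 2) * pow_series (dh_coeff \<nu>) (z\<^sup>2)"
proof -
  define G where "G = complex_of_real (rGamma (\<nu> + 1))"
  have z: "z \<noteq> 0" "z / 2 \<notin> \<real>\<^sub>\<le>\<^sub>0" using assms(3) by (auto simp: complex_nonpos_Reals_iff)
  have pow: "((\<lambda>z. bessel_pow \<nu> (z / 2)) has_field_derivative of_real \<nu> * bessel_pow \<nu> (z / 2) / z) (at z)"
  proof (cases "\<nu> = 0")
    case True
    then show ?thesis by (simp add: bessel_pow_def)
  next
    case False
    have "((\<lambda>z. (z / 2) powr of_real \<nu>) has_field_derivative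
        of_real \<nu> * (z / 2) powr (of_real \<nu> - 1) * (1 / 2)) (at z)"
      by (rule DERIV_chain2[where f="\<lambda>w. w powr of_real \<nu>" and g="\<lambda>z. z / 2", OF has_field_derivative_powr[OF z(2)]]) (auto intro!: derivative_eq_intros)
    then show ?thesis using False z by (simp add: bessel_pow_def powr_diff)
  qed
  have "((\<lambda>z. pow_series (bessel_coeff \<nu>) (z\<^sup>2)) has_field_derivative pow_series (diffs (bessel_coeff \<nu>)) (z\<^sup>2) * (2 * z)) (at z)"
    by (rule DERIV_chain2[OF has_field_derivative_pow_series[OF entire_bessel_coeff[OF assms(1,2)]]])
       (auto intro!: derivative_eq_intros)
  then have "((\<lambda>z. G * (bessel_pow \<nu> (z / 2) * pow_series (bessel_coeff \<nu>) (z\<^sup>2))) has_field_derivative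
      G * (of_real \<nu> * bessel_pow \<nu> (z / 2) / z * pow_series (bessel_coeff \<nu>) (z\<^sup>2) +
        pow_series (diffs (bessel_coeff \<nu>)) (z\<^sup>2) * (2 * z) * bessel_pow \<nu> (z / 2))) (at z)"
    by (intro DERIV_cmult DERIV_mult pow)
  moreover have "bessel_J \<nu> = (\<lambda>z. G * (bessel_pow \<nu> (z / 2) * pow_series (bessel_coeff \<nu>) (z\<^sup>2)))"
    using bessel_J_eq[OF assms(1,2)] by (auto simp: G_def mult.assoc)
  ultimately have "deriv (bessel_J \<nu>) z =
      G * (of_real \<nu> * bessel_pow \<nu> (z / 2) / z * pow_series (bessel_coeff \<nu>) (z\<^sup>2) +
        pow_series (diffs (bessel_coeff \<nu>)) (z\<^sup>2) * (2 * z) * bessel_pow \<nu> (z / 2))"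
    by (auto intro!: DERIV_imp_deriv)
  then have "dini \<nu> z = of_real (2 - \<nu>) * (G * bessel_pow \<nu> (z / 2) * pow_series (bessel_coeff \<nu>) (z\<^sup>2)) +
     z * (G * (of_real \<nu> * bessel_pow \<nu> (z / 2) / z * pow_series (bessel_coeff \<nu>) (z\<^sup>2) +
        pow_series (diffs (bessel_coeff \<nu>)) (z\<^sup>2) * (2 * z) * bessel_pow \<nu> (z / 2)))"
    unfolding dini_def by (simp add: bessel_J_eq[OF assms(1,2)] G_def)
  also have "\<dots> = 2 * G * bessel_pow \<nu> (z / 2) * pow_series (dh_coeff \<nu>) (z\<^sup>2)"
    using z by (simp add: pow_series_dh_coeff[OF assms(1,2)] field_simps power2_eq_square)
  finally show ?thesis by (simp add: G_def)
qed

lemma dini_eq_0_iff: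
  assumes "\<nu> > -2" "\<nu> \<noteq> -1" "z \<notin> \<real>\<^sub>\<le>\<^sub>0"
  shows "dini \<nu> z = 0 \<longleftrightarrow> pow_series (dh_coeff \<nu>) (z\<^sup>2) = 0"
proof -
  have "z / 2 \<noteq> 0" using assms(3) by auto
  from bessel_pow_nonzero[OF this] rGamma_nonzero[OF assms(1,2)] show ?thesis
    by (simp add: dini_eq[OF assms])
qed

section \<open>Rewriting the equations for the radius\<close>

text \<open>One computation for both equations: \<open>A\<close> and \<open>B\<close> stand for
  \<open>J_\<nu>(s)\<close> and \<open>s J_(\<nu>+1)(s)\<close>, or for \<open>I_\<nu>(s)\<close>
  and \<open>-s I_(\<nu>+1)(s)\<close>. The quotient is \<open>2 z h''/h'\<close>, so adding 1 and
  equating to 0 says \<open>z h''/h' = -1/2\<close>.\<close>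

lemma uc_lhs_eq_aux:
  fixes A B K w z :: complex
  assumes "K \<noteq> 0" "\<nu> > -2" "\<nu> \<noteq> -1"
    "A = K * pow_series (bessel_coeff \<nu>) z" "B = - 2 * z * K * pow_series (diffs (bessel_coeff \<nu>)) z"
  shows "(2 * (of_real \<nu> - 1) * B - z * A) / (2 * A - B) =
           2 * pow_series (\<lambda>n. real n * dh_coeff \<nu> n) z / pow_series (dh_coeff \<nu>) z"
proof -
  have "2 * (of_real \<nu> - 1) * B - z * A = (2 * K) * (2 * pow_series (\<lambda>n. real n * dh_coeff \<nu> n) z)"
    unfolding assms(4,5) pow_series_nat_dh_coeff[OF assms(2,3)] by (simp add: algebra_simps)
  moreover have "2 * A - B = (2 * K) * pow_series (dh_coeff \<nu>) z"
    unfolding assms(4,5) pow_series_dh_coeff[OF assms(2,3)] by (simp add: algebra_simps)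
  ultimately show ?thesis using assms(1) by simp
qed

text \<open>The series argument \<open>z\<close> is left free: it becomes the square of
  \<open>s\<close> for \<open>bessel_J\<close> and its negative for \<open>bessel_I\<close>.\<close>

lemma bessel_succ_aux:
  assumes "\<nu> > -2" "\<nu> \<noteq> -1" "s \<noteq> 0"
  shows "s * (of_real (rGamma (\<nu> + 1 + 1)) * bessel_pow (\<nu> + 1) (s / 2) * pow_series (bessel_coeff (\<nu> + 1)) z) =
    - 2 * s\<^sup>2 * (of_real (rGamma (\<nu> + 1)) * bessel_pow \<nu> (s / 2)) * pow_series (diffs (bessel_coeff \<nu>)) z"
proof -
  have "complex_of_real (rGamma (\<nu> + 1)) = of_real (\<nu> + 1) * of_real (rGamma (\<nu> + 1 + 1))"
    by (simp only: of_real_mult[symmetric] rGamma_plus1)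
  then show ?thesis
    using assms by (simp add: bessel_pow_add_1 pow_series_bessel_coeff_succ power2_eq_square) (simp add: algebra_simps)
qed

lemma uc_lhs_J_eq:
  assumes "\<nu> > -2" "\<nu> \<noteq> -1" "r > 0"
  shows "uc_lhs_J \<nu> r = of_real (1 + 2 * pow_series (\<lambda>n. real n * dh_coeff \<nu> n) r / pow_series (dh_coeff \<nu>) r)"
proof -
  define s where "s = complex_of_real (sqrt r)"
  have s: "s\<^sup>2 = of_real r" "s \<noteq> 0" using assms by (auto simp: s_def simp flip: of_real_power)
  define K where "K = of_real (rGamma (\<nu> + 1)) * bessel_pow \<nu> (s / 2)"
  have K: "K \<noteq> 0" using rGamma_nonzero[OF assms(1,2)] s bessel_pow_nonzero[of "s / 2" \<nu>] by (simp add: K_def)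
  have "s * ((2 * (of_real \<nu> - 1) * bessel_J (\<nu> + 1) s - s * bessel_J \<nu> s) /
              (2 * bessel_J \<nu> s - s * bessel_J (\<nu> + 1) s)) =
    (2 * (of_real \<nu> - 1) * (s * bessel_J (\<nu> + 1) s) - of_real r * bessel_J \<nu> s) /
              (2 * bessel_J \<nu> s - s * bessel_J (\<nu> + 1) s)"
    unfolding s(1)[symmetric] by (simp add: power2_eq_square algebra_simps)
  also have "\<dots> = 2 * pow_series (\<lambda>n. real n * dh_coeff \<nu> n) (complex_of_real r) / pow_series (dh_coeff \<nu>) (of_real r)"
  proof (rule uc_lhs_eq_aux[OF K assms(1,2)])
    show "bessel_J \<nu> s = K * pow_series (bessel_coeff \<nu>) (complex_of_real r)"
      by (simp add: bessel_J_eq[OF assms(1,2)] s K_def)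
    show "s * bessel_J (\<nu> + 1) s = - 2 * of_real r * K * pow_series (diffs (bessel_coeff \<nu>)) (of_real r)"
      using bessel_succ_aux[OF assms(1,2) s(2), of "of_real r"] assms
      by (subst bessel_J_eq) (simp_all add: s K_def)
  qed
  finally show ?thesis
    using entire_dh_coeff[OF assms(1,2)]
    by (simp add: uc_lhs_J_def Let_def s_def[symmetric] pow_series_of_real entire_coeffs_nat_mult)
qed

lemma uc_lhs_I_eq:
  assumes "\<nu> > -2" "\<nu> \<noteq> -1" "r > 0"
  shows "uc_lhs_I \<nu> r = of_real (1 + 2 * pow_series (\<lambda>n. real n * dh_coeff \<nu> n) (- r) / pow_series (dh_coeff \<nu>) (- r))"
proof -
  define s where "s = complex_of_real (sqrt r)"
  have s: "s\<^sup>2 = of_real r" "s \<noteq> 0" using assms by (auto simp: s_def simp flip: of_real_power)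
  define K where "K = of_real (rGamma (\<nu> + 1)) * bessel_pow \<nu> (s / 2)"
  have K: "K \<noteq> 0" using rGamma_nonzero[OF assms(1,2)] s bessel_pow_nonzero[of "s / 2" \<nu>] by (simp add: K_def)
  have "s * ((s * bessel_I \<nu> s - 2 * (of_real \<nu> - 1) * bessel_I (\<nu> + 1) s) /
              (2 * bessel_I \<nu> s + s * bessel_I (\<nu> + 1) s)) =
    (2 * (of_real \<nu> - 1) * (- (s * bessel_I (\<nu> + 1) s)) - of_real (- r) * bessel_I \<nu> s) /
              (2 * bessel_I \<nu> s - (- (s * bessel_I (\<nu> + 1) s)))"
    unfolding of_real_minus s(1)[symmetric] by (simp add: power2_eq_square algebra_simps)
  also have "\<dots> = 2 * pow_series (\<lambda>n. real n * dh_coeff \<nu> n) (complex_of_real (- r)) / pow_series (dh_coeff \<nu>) (of_real (- r))"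
  proof (rule uc_lhs_eq_aux[OF K assms(1,2)])
    show "bessel_I \<nu> s = K * pow_series (bessel_coeff \<nu>) (complex_of_real (- r))"
      by (simp add: bessel_I_eq[OF assms(1,2)] s K_def)
    show "- (s * bessel_I (\<nu> + 1) s) = - 2 * of_real (- r) * K * pow_series (diffs (bessel_coeff \<nu>)) (of_real (- r))"
      using bessel_succ_aux[OF assms(1,2) s(2), of "of_real (- r)"] assms
      by (subst bessel_I_eq) (simp_all add: s K_def)
  qed
  finally show ?thesis
    using entire_dh_coeff[OF assms(1,2)]
    by (simp only: uc_lhs_I_def Let_def s_def[symmetric] pow_series_of_real entire_coeffs_nat_mult) simp
qed

section \<open>Zeros of the approximating polynomials\<close>

text \<open>\<open>N\<close> distinct real roots exhaust a nonzero polynomial of degree at most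
  \<open>N\<close>, so the same simple real factors also describe it at complex points.\<close>

lemma poly_of_real_prod_roots:
  fixes p :: "real poly" and z :: complex
  assumes "finite B" "card B = N" "\<And>b. b \<in> B \<Longrightarrow> poly p b = 0" "poly p 0 = 1" "degree p \<le> N"
  shows "poly (map_poly of_real p) z = (\<Prod>b\<in>B. 1 - z / of_real b)" (is ?complex)
    and "p = (\<Prod>b\<in>B. [:1, - (1 / b):])" (is ?real)
proof -
  have "p \<noteq> 0" using assms(4) by auto
  then have "card B \<le> degree p"
    using assms(3) by (intro order_trans[OF card_mono card_poly_roots_bound] poly_roots_finite) auto
  then have deg: "card B = degree p" using assms by simp
  show ?real using assms by (intro poly_eq_prod_roots deg)
  have ev: "poly (map_poly of_real p) (of_real x) = complex_of_real (poly p x)" for x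
    by (induction p) (auto simp: map_poly_pCons)
  have inj: "inj_on complex_of_real B" by (simp add: inj_on_def)
  have "map_poly of_real p = (\<Prod>a\<in>complex_of_real ` B. [:1, - (1 / a):])"
    using assms ev[of 0] deg inj
    by (intro poly_eq_prod_roots) (auto simp: card_image degree_map_poly ev)
  then have "map_poly of_real p = (\<Prod>b\<in>B. [:1, - (1 / complex_of_real b):])"
    by (simp add: prod.reindex[OF inj])
  then show ?complex by (simp add: poly_prod)
qed

lemma approx_dh_coeff:
  assumes "N > 0"
  shows "approx_weight N n * dh_coeff \<nu> n = coeff (dlaguerre N \<nu>) n / (4 * real N) ^ n"
proof -
  have "(-1 / 4 :: real) ^ n = (-1) ^ n / 4 ^ n" by (rule power_divide)
  with assms show ?thesis
    by (simp add: approx_weight_def dh_coeff_def bessel_coeff_def coeff_dlaguerre coeff_laguerre power_mult_distrib mult_ac)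
qed

lemma approx_bessel_coeff:
  assumes "N > 0"
  shows "approx_weight N n * bessel_coeff \<nu> n = coeff (laguerre N \<nu>) n / (4 * real N) ^ n"
proof -
  have "(-1 / 4 :: real) ^ n = (-1) ^ n / 4 ^ n" by (rule power_divide)
  with assms show ?thesis
    by (simp add: approx_weight_def bessel_coeff_def coeff_laguerre power_mult_distrib mult_ac)
qed

text \<open>The sum is the negated linear coefficient. It does not depend on \<open>N\<close>, since
  the weight at \<open>n = 1\<close> is 1, and its sign decides which zero dominates.\<close>

lemma approx_dh_prod:
  fixes z :: complex
  assumes "N > 0" "finite B" "card B = N" "\<And>b. b \<in> B \<Longrightarrow> poly (dlaguerre N \<nu>) b = 0"
  defines "C \<equiv> (\<lambda>b. 1 / (4 * real N * b)) ` B"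
  shows "pow_series (\<lambda>n. approx_weight N n * dh_coeff \<nu> n) z = (\<Prod>c\<in>C. 1 - of_real c * z)"
    and "sum (\<lambda>c. c) C = 1 / (2 * (\<nu> + 1))"
proof -
  have inj: "inj_on (\<lambda>b. 1 / (4 * real N * b)) B"
    using assms(1) by (auto simp: inj_on_def)
  note P = poly_of_real_prod_roots[OF assms(2,3) assms(4) poly_dlaguerre_0 degree_dlaguerre_le]
  show "pow_series (\<lambda>n. approx_weight N n * dh_coeff \<nu> n) z = (\<Prod>c\<in>C. 1 - of_real c * z)"
    unfolding approx_dh_coeff[OF assms(1)] pow_series_coeff_poly C_def prod.reindex[OF inj]
    by (subst P(1)) (simp_all add: mult_ac)
  have "coeff (dlaguerre N \<nu>) 1 = - (\<Sum>b\<in>B. 1 / b)"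
    by (subst P(2), assumption) (rule coeff_prod_linear(2)[OF assms(2)])
  then have "- 2 * real N / (\<nu> + 1) = - (\<Sum>b\<in>B. 1 / b)"
    by (simp add: coeff_dlaguerre coeff_laguerre)
  then have "(\<Sum>b\<in>B. 1 / b) = 2 * real N / (\<nu> + 1)" by simp
  moreover have "sum (\<lambda>c. c) C = (\<Sum>b\<in>B. 1 / b) / (4 * real N)"
    unfolding C_def sum.reindex[OF inj] by (simp add: sum_divide_distrib mult_ac)
  ultimately have "sum (\<lambda>c. c) C = 2 * real N / (\<nu> + 1) / (4 * real N)" by (simp only:)
  also have "\<dots> = 1 / (2 * (\<nu> + 1))"
    using assms(1) by (cases "\<nu> + 1 = 0") (simp_all add: divide_simps)
  finally show "sum (\<lambda>c. c) C = 1 / (2 * (\<nu> + 1))" .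
qed

lemma approx_dh_prod_pos:
  assumes "\<nu> > -1" "N > 0"
  shows "\<exists>C. finite C \<and> (\<forall>c\<in>C. 0 < c) \<and>
    (\<forall>z::complex. pow_series (\<lambda>n. approx_weight N n * dh_coeff \<nu> n) z = (\<Prod>c\<in>C. 1 - of_real c * z))"
proof -
  obtain A where A: "finite A" "card A = N" "\<forall>x\<in>A. 0 < x \<and> poly (laguerre N \<nu>) x = 0"
    using laguerre_zeros_pos[OF assms(1)] by blast
  obtain B where B: "finite B" "card B = N" "\<forall>x\<in>B. 0 < x \<and> poly (dlaguerre N \<nu>) x = 0"
    using dlaguerre_zeros_pos[OF A] by blast
  have "poly (dlaguerre N \<nu>) b = 0" if "b \<in> B" for b using B that by blast
  from approx_dh_prod(1)[OF assms(2) B(1,2) this] B assms(2) show ?thesis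
    by (intro exI[of _ "(\<lambda>b. 1 / (4 * real N * b)) ` B"]) auto
qed

text \<open>The dominance of \<open>a\<close> is a matter of sign: the sum over \<open>C\<close>
  minus \<open>a\<close> equals 1/(2(\<nu>+1)), which is negative here.\<close>

lemma approx_dh_prod_neg:
  assumes "-2 < \<nu>" "\<nu> < -1" "N > 0"
  shows "\<exists>C a. finite C \<and> (\<forall>c\<in>C. 0 < c) \<and> 0 < a \<and> sum (\<lambda>c. c) C \<le> a \<and>
    (\<forall>z::complex. pow_series (\<lambda>n. approx_weight N n * dh_coeff \<nu> n) z = (\<Prod>c\<in>insert (-a) C. 1 - of_real c * z))"
proof -
  obtain M where N: "N = Suc M" using assms(3) by (cases N) auto
  obtain A a where A: "finite A" "card A = M" "\<forall>x\<in>A. 0 < x \<and> poly (laguerre N \<nu>) x = 0"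
    and a: "a < 0" "poly (laguerre N \<nu>) a = 0"
    using laguerre_zeros_neg[OF assms(1,2), of M] unfolding N by blast
  obtain B where B: "finite B" "card B = M" "\<forall>x\<in>B. 0 < x \<and> poly (dlaguerre N \<nu>) x = 0"
    using dlaguerre_zeros_pos[OF A] by blast
  obtain b where b: "b < 0" "poly (dlaguerre N \<nu>) b = 0"
    using dlaguerre_zeros_neg[OF a] by blast
  define C where "C = (\<lambda>b. 1 / (4 * real N * b)) ` B"
  define d where "d = - (1 / (4 * real N * b))"
  have d: "d > 0" using b assms(3) by (simp add: d_def mult_less_0_iff)
  have C: "finite C" "\<forall>c\<in>C. 0 < c" using B assms(3) by (auto simp: C_def)
  have "b \<notin> B" using B b by force
  then have card: "card (insert b B) = N" using B by (simp add: N)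
  have fin: "finite (insert b B)" using B by simp
  have roots: "poly (dlaguerre N \<nu>) x = 0" if "x \<in> insert b B" for x using B b that by blast
  have img: "(\<lambda>b. 1 / (4 * real N * b)) ` insert b B = insert (- d) C" by (simp add: C_def d_def)
  note P = approx_dh_prod[OF assms(3) fin card roots, unfolded img]
  have "- d \<notin> C" using C d by force
  then have "sum (\<lambda>c. c) C - d = 1 / (2 * (\<nu> + 1))" using P(2) C by simp
  also have "\<dots> < 0" using assms by (simp add: field_simps)
  finally show ?thesis using C d P(1) by (intro exI[of _ C] exI[of _ d]) auto
qed

text \<open>A Rayleigh-type estimate: if all zeros exceeded \<open>m\<close>, the sum
  \<open>t\<close> of squared reciprocals would be at most \<open>s / m\<close>. Here
  \<open>s / t\<close> is \<open>(\<nu> + 1)(\<nu> + 2) / (N + \<nu> + 1)\<close>, slightly below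
  \<open>m\<close>. After scaling by \<open>4 N\<close> the bound is free of \<open>N\<close>, so
  these zeros cannot escape to infinity.\<close>

lemma laguerre_small_zero:
  assumes "\<nu> > -1" "N > 0"
  shows "\<exists>b>0. b \<le> (\<nu> + 1) * (\<nu> + 2) / real N \<and> poly (laguerre N \<nu>) b = 0"
proof (rule ccontr)
  assume neg: "\<not> ?thesis"
  obtain B where B: "finite B" "card B = N" "\<forall>x\<in>B. 0 < x \<and> poly (laguerre N \<nu>) x = 0"
    using laguerre_zeros_pos[OF assms(1)] by blast
  define m where "m = (\<nu> + 1) * (\<nu> + 2) / real N"
  have m: "m > 0" using assms by (simp add: m_def)
  have large: "m < b \<and> 0 < b" if "b \<in> B" for b
    using neg B that unfolding m_def by (meson not_less)
  have roots: "poly (laguerre N \<nu>) x = 0" if "x \<in> B" for x using B that by blast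
  note P = poly_of_real_prod_roots(2)[OF B(1,2) roots poly_laguerre_0 degree_laguerre_le]
  define s where "s = (\<Sum>b\<in>B. 1 / b)"
  define t where "t = (\<Sum>b\<in>B. (1 / b)\<^sup>2)"
  have "coeff (laguerre N \<nu>) 1 = - s"
    unfolding s_def by (subst P, assumption) (rule coeff_prod_linear(2)[OF B(1)])
  then have s: "s = real N / (\<nu> + 1)" by (simp add: coeff_laguerre)
  have "s\<^sup>2 - t = 2 * coeff (laguerre N \<nu>) 2"
    unfolding s_def t_def by (subst P, assumption) (rule coeff_prod_linear(3)[OF B(1), symmetric])
  also have "\<dots> = real N * (real N - 1) / ((\<nu> + 1) * (\<nu> + 2))"
  proof -
    have "2 * real (N choose 2) = real N * (real N - 1)"
      using assms(2) choose_two[of N] by (cases N) (auto simp: real_of_nat_div algebra_simps)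
    moreover have "pochhammer (\<nu> + 1) 2 = (\<nu> + 1) * (\<nu> + 2)"
      by (simp add: numeral_2_eq_2 pochhammer_rec add_ac)
    ultimately show ?thesis by (simp add: coeff_laguerre)
  qed
  finally have "t = (real N / (\<nu> + 1))\<^sup>2 - real N * (real N - 1) / ((\<nu> + 1) * (\<nu> + 2))"
    by (simp add: s)
  also have "\<dots> = real N * (real N + \<nu> + 1) / ((\<nu> + 1)\<^sup>2 * (\<nu> + 2))"
  proof -
    have "(n / u)\<^sup>2 - n * (n - 1) / (u * (u + 1)) = n * (n + u) / (u\<^sup>2 * (u + 1))"
      if "u > 0" for n u :: real
      using that by (simp add: divide_simps power2_eq_square) (simp add: algebra_simps)
    from this[of "\<nu> + 1" "real N"] assms show ?thesis by (simp add: add_ac)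
  qed
  finally have "t = real N * (real N + \<nu> + 1) / ((\<nu> + 1)\<^sup>2 * (\<nu> + 2))" .
  moreover have "s / m = real N * real N / ((\<nu> + 1)\<^sup>2 * (\<nu> + 2))"
    using assms by (simp add: s m_def field_simps power2_eq_square)
  moreover have "real N * real N < real N * (real N + \<nu> + 1)" using assms by simp
  ultimately have "s / m < t" using assms by (simp add: divide_strict_right_mono)
  moreover have "t \<le> s / m"
    unfolding s_def t_def sum_divide_distrib
  proof (rule sum_mono)
    fix b assume "b \<in> B"
    with large[of b] m show "(1 / b)\<^sup>2 \<le> 1 / b / m" by (simp add: power2_eq_square field_simps)
  qed
  ultimately show False by simp
qed

section \<open>Passage to the limit\<close>

lemma compact_positive_lower_bound:
  fixes f :: "real \<Rightarrow> real"
  assumes "continuous_on {0..r} f" "\<And>x. 0 \<le> x \<Longrightarrow> x \<le> r \<Longrightarrow> 0 < f x"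
  obtains e where "e > 0" "\<And>x. 0 \<le> x \<Longrightarrow> x \<le> r \<Longrightarrow> e \<le> f x"
proof (cases "0 \<le> r")
  case True
  then obtain x where "x \<in> {0..r}" "\<forall>y\<in>{0..r}. f x \<le> f y"
    using continuous_attains_inf[OF compact_Icc _ assms(1)] by auto
  with assms(2)[of x] that[of "f x"] show ?thesis by auto
qed (use that[of 1] in auto)

text \<open>The polynomial estimate needs positivity of the approximants themselves. On the compact
  segment \<open>h'\<close> has a positive minimum, and uniform convergence within that margin keeps
  the approximants positive for large \<open>N\<close>.\<close>

lemma dh_bounds_pos:
  fixes z :: complex
  assumes "\<nu> > -1" and pos: "\<And>x::real. 0 \<le> x \<Longrightarrow> x \<le> norm z \<Longrightarrow> 0 < pow_series (dh_coeff \<nu>) x"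
  shows "pow_series (dh_coeff \<nu>) (norm z) \<le> norm (pow_series (dh_coeff \<nu>) z)"
    and "norm (pow_series (\<lambda>n. real n * dh_coeff \<nu> n) z) * pow_series (dh_coeff \<nu>) (norm z) \<le>
           - pow_series (\<lambda>n. real n * dh_coeff \<nu> n) (norm z) * norm (pow_series (dh_coeff \<nu>) z)"
proof -
  have e: "entire_coeffs (dh_coeff \<nu>)" using assms(1) by (intro entire_dh_coeff) auto
  note en = entire_coeffs_nat_mult[OF e]
  define d where "d = (\<lambda>N n. approx_weight N n * dh_coeff \<nu> n)"
  define d' where "d' = (\<lambda>N n. real n * d N n)"
  have d'_eq: "d' = (\<lambda>N n. approx_weight N n * (real n * dh_coeff \<nu> n))"
    by (simp add: d'_def d_def mult_ac)
  have lim: "(\<lambda>N. pow_series (d N) w) \<longlonglongrightarrow> pow_series (dh_coeff \<nu>) w"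
    "(\<lambda>N. pow_series (d' N) w) \<longlonglongrightarrow> pow_series (\<lambda>n. real n * dh_coeff \<nu> n) w"
    for w :: "'a::{real_normed_field,banach}"
    unfolding d'_eq d_def by (intro tendsto_approx e en)+
  obtain \<epsilon> where \<epsilon>: "\<epsilon> > 0" "\<And>x::real. 0 \<le> x \<Longrightarrow> x \<le> norm z \<Longrightarrow> \<epsilon> \<le> pow_series (dh_coeff \<nu>) x"
    using compact_positive_lower_bound[OF continuous_on_pow_series[OF e continuous_on_id] pos] by blast
  have "\<forall>\<^sub>F N in sequentially. \<forall>x\<in>cball 0 (norm z). dist (pow_series (d N) x) (pow_series (dh_coeff \<nu>) x :: real) < \<epsilon>"
    unfolding d_def by (rule uniform_limitD[OF uniform_limit_approx[OF e] \<epsilon>(1)])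
  then have "\<forall>\<^sub>F N in sequentially. pow_series (d N) (norm z) \<le> norm (pow_series (d N) z) \<and>
      norm (pow_series (d' N) z) * pow_series (d N) (norm z) \<le> - pow_series (d' N) (norm z) * norm (pow_series (d N) z)"
    using eventually_gt_at_top[of 0]
  proof eventually_elim
    case (elim N)
    obtain C where C: "finite C" "\<forall>c\<in>C. 0 < c" "\<forall>z::complex. pow_series (d N) z = (\<Prod>c\<in>C. 1 - of_real c * z)"
      using approx_dh_prod_pos[OF assms(1) elim(2)] unfolding d_def by blast
    have "0 < pow_series (d N) x" if "0 \<le> x" "x \<le> norm z" for x
    proof -
      have "dist (pow_series (d N) x) (pow_series (dh_coeff \<nu>) x) < \<epsilon>" using elim(1) that by simp
      with \<epsilon>(2)[OF that] show ?thesis by (simp add: dist_real_def)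
    qed
    moreover have "entire_coeffs (d N)" unfolding d_def by (rule entire_coeffs_approx[OF e])
    ultimately show ?case
      unfolding d'_def using log_deriv_bound_pos[of "d N" C z] C by blast
  qed
  then have ev: "\<forall>\<^sub>F N in sequentially. pow_series (d N) (norm z) \<le> norm (pow_series (d N) z)"
    "\<forall>\<^sub>F N in sequentially. norm (pow_series (d' N) z) * pow_series (d N) (norm z) \<le> - pow_series (d' N) (norm z) * norm (pow_series (d N) z)"
    by (auto elim: eventually_mono)
  show "pow_series (dh_coeff \<nu>) (norm z) \<le> norm (pow_series (dh_coeff \<nu>) z)"
    by (rule tendsto_le[OF _ tendsto_norm[OF lim(1)] lim(1) ev(1)]) simp
  show "norm (pow_series (\<lambda>n. real n * dh_coeff \<nu> n) z) * pow_series (dh_coeff \<nu>) (norm z) \<le>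
           - pow_series (\<lambda>n. real n * dh_coeff \<nu> n) (norm z) * norm (pow_series (dh_coeff \<nu>) z)"
    by (rule tendsto_le[OF _ _ _ ev(2)]) (auto intro!: tendsto_intros lim)
qed

text \<open>Every term after the constant one is nonincreasing in \<open>x\<close>, so the drop of
  the series is at least that of its linear term.\<close>

lemma pow_series_minus_decreasing:
  assumes "entire_coeffs c" "\<And>n. n \<ge> 1 \<Longrightarrow> (-1) ^ n * c n \<le> 0" "0 \<le> x" "x \<le> y"
  shows "c 1 * (y - x) \<le> pow_series c (- x) - pow_series c (- y :: real)"
proof -
  define D where "D = (\<lambda>n. c n * (- x) ^ n - c n * (- y) ^ n)"
  have sums: "summable (\<lambda>n. c n * (- x) ^ n)" "summable (\<lambda>n. c n * (- y) ^ n)"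
    using entire_coeffs_summable[OF assms(1), of "- x"] entire_coeffs_summable[OF assms(1), of "- y"] by simp_all
  have D0: "D n \<ge> 0" for n
  proof (cases "n \<ge> 1")
    case True
    have "D n = ((-1) ^ n * c n) * (x ^ n - y ^ n)"
      by (simp add: D_def power_minus[of x] power_minus[of y] algebra_simps)
    then show ?thesis using assms(2)[OF True] power_mono[OF assms(4,3), of n]
      by (simp add: mult_nonpos_nonpos)
  next
    case False
    then have "n = 0" by simp
    then show ?thesis by (simp add: D_def)
  qed
  have "(\<Sum>n\<in>{1}. D n) \<le> suminf D"
    using D0 sums by (intro sum_le_suminf) (auto simp: D_def intro: summable_diff)
  then show ?thesis
    using suminf_diff[OF sums] by (simp add: D_def pow_series_def algebra_simps)
qed

lemma dh_coeff_sign: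
  assumes "-2 < \<nu>" "\<nu> < -1"
  shows "n \<ge> 1 \<Longrightarrow> (-1) ^ n * dh_coeff \<nu> n \<le> 0" "dh_coeff \<nu> 1 > 0" "dh_coeff \<nu> 0 = 1"
proof -
  assume "n \<ge> 1"
  then obtain m where "n = Suc m" by (cases n) auto
  then have "pochhammer (\<nu> + 1) n < 0"
    using assms by (auto simp: pochhammer_rec intro!: mult_neg_pos pochhammer_pos)
  then have "(1 / 4) ^ n / (fact n * pochhammer (\<nu> + 1) n) \<le> 0"
    by (simp add: divide_nonneg_neg mult_pos_neg)
  then have "(real n + 1) * ((1 / 4) ^ n / (fact n * pochhammer (\<nu> + 1) n)) \<le> 0"
    by (intro mult_nonneg_nonpos) auto
  moreover have "(-1) ^ n * (-1 / 4 :: real) ^ n = (1 / 4) ^ n"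
    by (simp flip: power_mult_distrib)
  ultimately show "(-1) ^ n * dh_coeff \<nu> n \<le> 0"
    by (simp add: dh_coeff_def bessel_coeff_def mult_ac)
next
  show "dh_coeff \<nu> 1 > 0" using assms by (simp add: dh_coeff_def bessel_coeff_def field_simps)
  show "dh_coeff \<nu> 0 = 1" by (simp add: dh_coeff_def bessel_coeff_def)
qed

text \<open>The dominating \<open>a\<close> varies with \<open>N\<close>. Positivity at one point
  \<open>-\<rho>\<close> beyond \<open>|z|\<close> passes to the approximants and forces
  \<open>a \<rho> < 1\<close>, hence \<open>a |z| \<le> |z| / \<rho> < 1\<close> with a margin
  independent of \<open>N\<close>.\<close>

lemma dh_bounds_neg:
  fixes z :: complex
  assumes "-2 < \<nu>" "\<nu> < -1" "norm z < \<rho>" "0 < pow_series (dh_coeff \<nu>) (- \<rho>)"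
  shows "(1 - norm z / \<rho>)\<^sup>2 \<le> norm (pow_series (dh_coeff \<nu>) z)"
    and "norm (pow_series (\<lambda>n. real n * dh_coeff \<nu> n) z) * pow_series (dh_coeff \<nu>) (- norm z) \<le>
           - pow_series (\<lambda>n. real n * dh_coeff \<nu> n) (- norm z) * norm (pow_series (dh_coeff \<nu>) z)"
proof -
  have e: "entire_coeffs (dh_coeff \<nu>)" using assms by (intro entire_dh_coeff) auto
  note en = entire_coeffs_nat_mult[OF e]
  have \<rho>: "\<rho> > 0" using assms(3) norm_ge_zero[of z] by linarith
  define d where "d = (\<lambda>N n. approx_weight N n * dh_coeff \<nu> n)"
  define d' where "d' = (\<lambda>N n. real n * d N n)"
  have d'_eq: "d' = (\<lambda>N n. approx_weight N n * (real n * dh_coeff \<nu> n))"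
    by (simp add: d'_def d_def mult_ac)
  have lim: "(\<lambda>N. pow_series (d N) w) \<longlonglongrightarrow> pow_series (dh_coeff \<nu>) w"
    "(\<lambda>N. pow_series (d' N) w) \<longlonglongrightarrow> pow_series (\<lambda>n. real n * dh_coeff \<nu> n) w"
    for w :: "'a::{real_normed_field,banach}"
    unfolding d'_eq d_def by (intro tendsto_approx e en)+
  have "\<forall>\<^sub>F N in sequentially. 0 < pow_series (d N) (- \<rho>)"
    using lim(1)[of "- \<rho>"] assms(4) by (rule order_tendstoD)
  then have "\<forall>\<^sub>F N in sequentially. (1 - norm z / \<rho>)\<^sup>2 \<le> norm (pow_series (d N) z) \<and>
      norm (pow_series (d' N) z) * pow_series (d N) (- norm z) \<le> - pow_series (d' N) (- norm z) * norm (pow_series (d N) z)"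
    using eventually_gt_at_top[of 0]
  proof eventually_elim
    case (elim N)
    obtain C a where C: "finite C" "\<forall>c\<in>C. 0 < c" "\<forall>z::complex. pow_series (d N) z = (\<Prod>c\<in>insert (-a) C. 1 - of_real c * z)"
      and a: "0 < a" "sum (\<lambda>c. c) C \<le> a"
      using approx_dh_prod_neg[OF assms(1,2) elim(2)] unfolding d_def by blast
    have ed: "entire_coeffs (d N)" unfolding d_def by (rule entire_coeffs_approx[OF e])
    have sign: "(-1) ^ n * d N n \<le> 0" if "n \<ge> 1" for n
      using mult_nonneg_nonpos[OF approx_weight_bounds(1)[of N n] dh_coeff_sign(1)[OF assms(1,2) that]]
      by (simp add: d_def mult_ac)
    \<comment> \<open>The approximant vanishes at \<open>-1/a\<close> and does not increase from
      there towards \<open>-\<rho>\<close>, so it could not be positive at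
      \<open>-\<rho>\<close>.\<close>
    have a\<rho>: "a * \<rho> < 1"
    proof (rule ccontr)
      assume "\<not> a * \<rho> < 1"
      then have "1 / a \<le> \<rho>" using a by (simp add: field_simps)
      then have "d N 1 * (\<rho> - 1 / a) \<le> pow_series (d N) (- (1 / a)) - pow_series (d N) (- \<rho>)"
        using a by (intro pow_series_minus_decreasing ed sign) auto
      moreover have "d N 1 * (\<rho> - 1 / a) \<ge> 0"
        using \<open>1 / a \<le> \<rho>\<close> dh_coeff_sign(2)[OF assms(1,2)] approx_weight_bounds(1)[of N 1]
        by (simp add: d_def)
      moreover have "pow_series (d N) (- (1 / a)) = 0"
        using pow_series_prod_real(1)[OF ed C(3)[rule_format], of "- (1 / a)"] a C(1)
        by (simp add: prod_zero_iff)
      ultimately show False using elim(1) by linarith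
    qed
    have le: "a * norm z \<le> norm z / \<rho>"
      using mult_right_mono[of "a * \<rho>" 1 "norm z / \<rho>"] a\<rho> \<rho> by simp
    moreover have "norm z / \<rho> < 1" using assms(3) \<rho> by simp
    ultimately have "a * norm z < 1" by linarith
    note bounds = log_deriv_bound_neg[OF ed C(3)[rule_format] C(1) C(2)[rule_format] a this]
    have "(1 - norm z / \<rho>)\<^sup>2 \<le> (1 - a * norm z)\<^sup>2"
      using le \<open>norm z / \<rho> < 1\<close> by (intro power_mono) auto
    with bounds show ?case unfolding d'_def by auto
  qed
  then have ev: "\<forall>\<^sub>F N in sequentially. (1 - norm z / \<rho>)\<^sup>2 \<le> norm (pow_series (d N) z)"
    "\<forall>\<^sub>F N in sequentially. norm (pow_series (d' N) z) * pow_series (d N) (- norm z) \<le> - pow_series (d' N) (- norm z) * norm (pow_series (d N) z)"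
    by (auto elim: eventually_mono)
  show "(1 - norm z / \<rho>)\<^sup>2 \<le> norm (pow_series (dh_coeff \<nu>) z)"
    by (rule tendsto_lowerbound[OF tendsto_norm[OF lim(1)] ev(1)]) simp
  show "norm (pow_series (\<lambda>n. real n * dh_coeff \<nu> n) z) * pow_series (dh_coeff \<nu>) (- norm z) \<le>
           - pow_series (\<lambda>n. real n * dh_coeff \<nu> n) (- norm z) * norm (pow_series (dh_coeff \<nu>) z)"
    by (rule tendsto_le[OF _ _ _ ev(2)]) (auto intro!: tendsto_intros lim)
qed

section \<open>The radius of uniform convexity\<close>

lemma radius_uniform_convexity_eqI:
  assumes "R > 0" "fps_conv_radius (fps_expansion f 0) = \<infinity>"
    and inside: "\<And>z. norm z < R \<Longrightarrow> deriv f z \<noteq> 0 \<and> norm (z * deriv (deriv f) z / deriv f z) < 1 / 2"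
    and bdry: "norm w = R" "w * deriv (deriv f) w / deriv f w = - 1 / 2"
  shows "radius_uniform_convexity f = ereal R"
  unfolding radius_uniform_convexity_def
proof (rule Sup_eqI)
  fix y
  assume "y \<in> {ereal r | r. 0 < r \<and> ereal r < fps_conv_radius (fps_expansion f 0) \<and>
            (\<forall>z\<in>ball 0 r. deriv f z \<noteq> 0 \<and>
               Re (1 + z * deriv (deriv f) z / deriv f z)
                 > cmod (z * deriv (deriv f) z / deriv f z))}"
  then obtain r where r: "y = ereal r" "\<And>z. z \<in> ball 0 r \<Longrightarrow> Re (1 + z * deriv (deriv f) z / deriv f z)
                 > cmod (z * deriv (deriv f) z / deriv f z)" by blast
  show "y \<le> ereal R"
  proof (rule ccontr)
    assume "\<not> y \<le> ereal R"
    \<comment> \<open>At \<open>w\<close> both sides of the strict inequality equal 1/2.\<close>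
    then have "w \<in> ball 0 r" using r(1) bdry(1) by simp
    from r(2)[OF this] show False unfolding bdry(2) by simp
  qed
next
  fix y
  assume y: "\<And>z. z \<in> {ereal r | r. 0 < r \<and> ereal r < fps_conv_radius (fps_expansion f 0) \<and>
            (\<forall>z\<in>ball 0 r. deriv f z \<noteq> 0 \<and>
               Re (1 + z * deriv (deriv f) z / deriv f z)
                 > cmod (z * deriv (deriv f) z / deriv f z))} \<Longrightarrow> z \<le> y"
  have "Re (1 + z * deriv (deriv f) z / deriv f z) > cmod (z * deriv (deriv f) z / deriv f z)"
    if "z \<in> ball 0 R" for z
  proof -
    have "norm (z * deriv (deriv f) z / deriv f z) < 1 / 2" using inside[of z] that by simp
    then show ?thesis
      using abs_Re_le_cmod[of "z * deriv (deriv f) z / deriv f z"] unfolding plus_complex.sel one_complex.sel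
      by linarith
  qed
  then show "ereal R \<le> y" using assms(1,2) inside by (intro y) auto
qed

lemma least_pos_zero_exists:
  fixes f :: "real \<Rightarrow> real"
  assumes "continuous_on {0..c} f" "f 0 > 0" "c > 0" "f c = 0"
  shows "\<exists>x>0. x \<le> c \<and> f x = 0 \<and> (\<forall>y. 0 \<le> y \<and> y < x \<longrightarrow> f y > 0)"
proof -
  define S where "S = {x \<in> {0..c}. f x = 0}"
  have "closed S"
    unfolding S_def by (rule continuous_closed_preimage_constant[OF assms(1) closed_atLeastAtMost])
  moreover have "bounded S"
    unfolding S_def by (rule bounded_subset[OF bounded_closed_interval[of 0 c]]) blast
  ultimately have "compact S" by (simp add: compact_eq_bounded_closed)
  moreover have "S \<noteq> {}" using assms(3,4) by (force simp: S_def)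
  ultimately obtain x where x: "x \<in> S" "\<And>y. y \<in> S \<Longrightarrow> x \<le> y"
    using compact_attains_inf[of S] by blast
  then have x': "0 \<le> x" "x \<le> c" "f x = 0" by (simp_all add: S_def)
  have "f y > 0" if y: "0 \<le> y" "y < x" for y
  proof (rule ccontr)
    assume "\<not> f y > 0"
    moreover have "continuous_on {0..y} f"
      using y x' by (intro continuous_on_subset[OF assms(1)]) auto
    ultimately obtain w where w: "0 \<le> w" "w \<le> y" "f w = 0"
      using IVT2'[of f y 0 0] assms(2) y(1) by auto
    then have "w \<in> S" using x' y by (simp add: S_def)
    from x(2)[OF this] w y show False by simp
  qed
  moreover have "x \<noteq> 0" using x'(3) assms(2) by auto
  ultimately show ?thesis using x' by (intro exI[of _ x]) auto
qed

text \<open>Without a zero the series would stay above some positive margin on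
  \<open>[0, M]\<close>, yet each approximant vanishes somewhere in this fixed interval and the
  convergence is uniform.\<close>

lemma pow_series_bessel_coeff_zero_exists:
  assumes "\<nu> > -1"
  obtains x :: real where "x > 0" "pow_series (bessel_coeff \<nu>) x = 0"
proof (rule ccontr)
  assume neg: "\<not> thesis"
  note zero = that
  have e: "entire_coeffs (bessel_coeff \<nu>)" using assms by (intro entire_bessel_coeff) auto
  have b0: "pow_series (bessel_coeff \<nu>) 0 = (1 :: real)" by (simp add: pow_series_0 bessel_coeff_def)
  have pos: "0 < pow_series (bessel_coeff \<nu>) x" if x: "0 \<le> x" for x :: real
  proof (rule ccontr)
    assume "\<not> 0 < pow_series (bessel_coeff \<nu>) x"
    then obtain w :: real where "0 \<le> w" "pow_series (bessel_coeff \<nu>) w = 0"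
      using IVT2'[of "pow_series (bessel_coeff \<nu>)" x 0 0] continuous_on_pow_series[OF e continuous_on_id, of "{0..x}"] x
      by (auto simp: b0)
    then show False using neg zero[of w] b0 by (cases "w = 0") auto
  qed
  \<comment> \<open>The bound for the smallest Laguerre zero times \<open>4 N\<close>, the scale of
    the approximants.\<close>
  define M where "M = 4 * ((\<nu> + 1) * (\<nu> + 2))"
  obtain \<epsilon> where \<epsilon>: "\<epsilon> > 0" "\<And>x::real. 0 \<le> x \<Longrightarrow> x \<le> M \<Longrightarrow> \<epsilon> \<le> pow_series (bessel_coeff \<nu>) x"
    using compact_positive_lower_bound[OF continuous_on_pow_series[OF e continuous_on_id] pos] by blast
  have "\<forall>\<^sub>F N in sequentially. \<forall>x\<in>cball 0 M.
      dist (pow_series (\<lambda>n. approx_weight N n * bessel_coeff \<nu> n) x) (pow_series (bessel_coeff \<nu>) x :: real) < \<epsilon>"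
    by (rule uniform_limitD[OF uniform_limit_approx[OF e] \<epsilon>(1)])
  with eventually_gt_at_top[of 0] have "\<forall>\<^sub>F N in sequentially. False"
  proof eventually_elim
    case (elim N)
    obtain b where b: "b > 0" "b \<le> (\<nu> + 1) * (\<nu> + 2) / real N" "poly (laguerre N \<nu>) b = 0"
      using laguerre_small_zero[OF assms elim(1)] by blast
    define x where "x = 4 * real N * b"
    have x: "0 < x" "x \<le> M" using b elim(1) by (auto simp: x_def M_def field_simps)
    have "map_poly of_real (laguerre N \<nu>) = laguerre N \<nu>"
      by (rule poly_eqI) (simp add: coeff_map_poly)
    then have "pow_series (\<lambda>n. approx_weight N n * bessel_coeff \<nu> n) x = 0"
      unfolding approx_bessel_coeff[OF elim(1)] pow_series_coeff_poly
      using b elim(1) by (simp add: x_def)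
    moreover have "x \<in> cball 0 M" using x by simp
    ultimately have "dist 0 (pow_series (bessel_coeff \<nu>) x) < \<epsilon>" using elim(2)[rule_format, of x] by simp
    with \<epsilon>(2)[of x] x show False by (simp add: dist_real_def)
  qed
  then show False by simp
qed

text \<open>Here \<open>A / B\<close> is \<open>z h''/h'\<close> at \<open>z\<close>, and
  \<open>q / p\<close> is the same quotient at the extremal real point; \<open>p + 2 q > 0\<close>
  says that the latter exceeds -1/2.\<close>

lemma norm_div_less_half:
  fixes A B :: complex and p q :: real
  assumes "norm A * p \<le> - q * norm B" "p > 0" "p + 2 * q > 0" "B \<noteq> 0"
  shows "norm (A / B) < 1 / 2"
proof -
  have "(2 * norm A) * p \<le> (- (2 * q)) * norm B" using assms(1) by (simp add: mult.commute)
  also have "\<dots> < p * norm B" using assms by (intro mult_strict_right_mono) auto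
  finally have "2 * norm A < norm B" using assms(2) by (simp add: mult.commute[of p])
  with assms(4) show ?thesis by (simp add: norm_divide divide_simps)
qed

section \<open>The case \<nu> > -1\<close>

lemma bessel_uc_radius_pos:
  assumes "\<nu> > -1"
  shows "\<exists>r \<beta> j. is_least_pos_zero (uc_lhs_J \<nu>) r \<and>
          is_least_pos_zero (\<lambda>x. dini \<nu> (complex_of_real x)) \<beta> \<and>
          is_least_pos_zero (\<lambda>x. bessel_J \<nu> (complex_of_real x)) j \<and>
          radius_uniform_convexity (bessel_h \<nu>) = ereal r \<and>
          r < \<beta>\<^sup>2 \<and> \<beta>\<^sup>2 < j\<^sup>2"
proof -
  have \<nu>: "\<nu> > -2" "\<nu> \<noteq> -1" using assms by auto
  note eb = entire_bessel_coeff[OF \<nu>] and e = entire_dh_coeff[OF \<nu>]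
  note en = entire_coeffs_nat_mult[OF e]
  define H D E where "H = (\<lambda>x::real. pow_series (bessel_coeff \<nu>) x)"
    and "D = (\<lambda>x::real. pow_series (dh_coeff \<nu>) x)"
    and "E = (\<lambda>x::real. pow_series (\<lambda>n. real n * dh_coeff \<nu> n) x)"
  have cont [continuous_intros]: "continuous_on S (\<lambda>x. H (f x))" "continuous_on S (\<lambda>x. D (f x))" "continuous_on S (\<lambda>x. E (f x))"
    if "continuous_on S f" for S and f :: "real \<Rightarrow> real"
    unfolding H_def D_def E_def by (intro continuous_on_pow_series eb e en that)+
  have at0: "H 0 = 1" "D 0 = 1" "E 0 = 0"
    by (auto simp: H_def D_def E_def pow_series_0 bessel_coeff_def dh_coeff_def)

  have J0: "bessel_J \<nu> (complex_of_real x) = 0 \<longleftrightarrow> H (x\<^sup>2) = 0" if "x > 0" for x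
    using that rGamma_nonzero[OF \<nu>] bessel_pow_nonzero[of "of_real x / 2" \<nu>] pow_series_of_real[OF eb, of "x\<^sup>2", where 'a=complex]
    by (simp add: bessel_J_eq[OF \<nu>] H_def)
  have dini0: "dini \<nu> (complex_of_real x) = 0 \<longleftrightarrow> D (x\<^sup>2) = 0" if "x > 0" for x
    using that pow_series_of_real[OF e, of "x\<^sup>2", where 'a=complex]
    by (subst dini_eq_0_iff[OF \<nu>]) (auto simp: D_def complex_nonpos_Reals_iff)

  obtain x where "x > 0" "H x = 0"
    using pow_series_bessel_coeff_zero_exists[OF assms] unfolding H_def by blast
  moreover have "continuous_on {0..sqrt x} (\<lambda>y. H (y\<^sup>2))" by (intro continuous_intros)
  ultimately obtain j where j: "0 < j" "H (j\<^sup>2) = 0" "\<And>y. 0 \<le> y \<Longrightarrow> y < j \<Longrightarrow> H (y\<^sup>2) > 0"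
    using least_pos_zero_exists[of "sqrt x" "\<lambda>y. H (y\<^sup>2)"] at0 by auto
  \<comment> \<open>Rolle's theorem for \<open>h(x) = x H x\<close> between 0 and the square of
    \<open>j\<close> places a zero of \<open>h'\<close> strictly below that square.\<close>
  have "((\<lambda>x. x * H x) has_real_derivative D x) (at x)" for x
    unfolding H_def D_def
    by (auto intro!: derivative_eq_intros has_field_derivative_pow_series eb simp: pow_series_dh_coeff[OF \<nu>])
  moreover have "continuous_on {0..j\<^sup>2} (\<lambda>x. x * H x)" by (intro continuous_intros)
  ultimately obtain y where y: "0 < y" "y < j\<^sup>2" "D y = 0"
    using Rolle_between_zeros[of 0 "j\<^sup>2" "\<lambda>x. x * H x" D] j by auto
  moreover have "continuous_on {0..sqrt y} (\<lambda>y. D (y\<^sup>2))" by (intro continuous_intros)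
  ultimately obtain \<beta> where \<beta>: "0 < \<beta>" "\<beta> \<le> sqrt y" "D (\<beta>\<^sup>2) = 0" "\<And>y. 0 \<le> y \<Longrightarrow> y < \<beta> \<Longrightarrow> D (y\<^sup>2) > 0"
    using least_pos_zero_exists[of "sqrt y" "\<lambda>y. D (y\<^sup>2)"] at0 by auto
  have \<beta>j: "\<beta>\<^sup>2 < j\<^sup>2"
    using power_mono[OF \<beta>(2), of 2] \<beta>(1) y by simp
  have Dpos: "D x > 0" if "0 \<le> x" "x < \<beta>\<^sup>2" for x
    using \<beta>(4)[of "sqrt x"] that \<beta>(1) by (simp add: real_less_lsqrt)

  \<comment> \<open>The square substitution produces the coefficient 2 of the equation for the
    radius. Rolle's theorem between 0 and \<beta> then gives a root strictly below the square of
    \<beta>.\<close>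
  have "((\<lambda>x. x * D (x\<^sup>2)) has_real_derivative D (x\<^sup>2) + 2 * E (x\<^sup>2)) (at x)" for x
  proof -
    have "((\<lambda>x. D (x\<^sup>2)) has_real_derivative pow_series (diffs (dh_coeff \<nu>)) (x\<^sup>2) * (2 * x)) (at x)"
      unfolding D_def
      by (rule DERIV_chain2[OF has_field_derivative_pow_series[OF e]]) (auto intro!: derivative_eq_intros)
    from DERIV_mult[OF DERIV_ident this] show ?thesis
      unfolding E_def mult_pow_series_diffs[OF e, symmetric] by (simp add: power2_eq_square algebra_simps)
  qed
  moreover have "continuous_on {0..\<beta>} (\<lambda>x. x * D (x\<^sup>2))" by (intro continuous_intros)
  ultimately obtain w where w: "0 < w" "w < \<beta>" "D (w\<^sup>2) + 2 * E (w\<^sup>2) = 0"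
    using Rolle_between_zeros[of 0 \<beta> "\<lambda>x. x * D (x\<^sup>2)" "\<lambda>x. D (x\<^sup>2) + 2 * E (x\<^sup>2)"] \<beta> by auto
  have "continuous_on {0..w\<^sup>2} (\<lambda>x. D x + 2 * E x)" by (intro continuous_intros)
  then obtain r where r: "0 < r" "r \<le> w\<^sup>2" "D r + 2 * E r = 0"
      "\<And>y. 0 \<le> y \<Longrightarrow> y < r \<Longrightarrow> D y + 2 * E y > 0"
    using least_pos_zero_exists[of "w\<^sup>2" "\<lambda>x. D x + 2 * E x"] at0 w by auto
  have r\<beta>: "r < \<beta>\<^sup>2" using r(2) power_strict_mono[OF w(2), of 2] w(1) by simp
  \<comment> \<open>Up to \<open>r\<close> the denominator \<open>D\<close> is positive, so
    multiplying it out neither creates nor loses roots.\<close>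
  have uc: "uc_lhs_J \<nu> x = 0 \<longleftrightarrow> D x + 2 * E x = 0" if "0 < x" "x \<le> r" for x
  proof -
    have "D x > 0" using Dpos[of x] that r\<beta> by simp
    moreover have "uc_lhs_J \<nu> x = of_real (1 + 2 * E x / D x)"
      using uc_lhs_J_eq[OF \<nu> that(1)] by (simp add: D_def E_def)
    ultimately show ?thesis by (simp only: of_real_eq_0_iff) (simp add: field_simps)
  qed
  have "radius_uniform_convexity (bessel_h \<nu>) = ereal r"
  proof (rule radius_uniform_convexity_eqI[OF r(1) conv_radius_bessel_h[OF \<nu>]])
    fix z :: complex assume z: "norm z < r"
    have pos: "0 < pow_series (dh_coeff \<nu>) x" if "0 \<le> x" "x \<le> norm z" for x :: real
      using Dpos[of x] that z r\<beta> by (simp add: D_def)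
    note bounds = dh_bounds_pos[OF assms, of z, OF pos]
    have nz: "pow_series (dh_coeff \<nu>) z \<noteq> 0" using bounds(1) pos[of "norm z"] by auto
    moreover have "norm (pow_series (\<lambda>n. real n * dh_coeff \<nu> n) z / pow_series (dh_coeff \<nu>) z) < 1 / 2"
      using r(4)[of "norm z"] z pos[of "norm z"]
      by (intro norm_div_less_half[OF bounds(2) _ _ nz]) (auto simp: D_def E_def)
    ultimately show "deriv (bessel_h \<nu>) z \<noteq> 0 \<and>
        norm (z * deriv (deriv (bessel_h \<nu>)) z / deriv (bessel_h \<nu>) z) < 1 / 2"
      unfolding deriv_bessel_h(2)[OF \<nu>] unfolding deriv_bessel_h(1)[OF \<nu>] by blast
  next
    show "norm (complex_of_real r) = r" using r by simp
    have "E r / D r = - 1 / 2" using r(3) Dpos[OF _ r\<beta>] r(1) by (simp add: field_simps)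
    then have "complex_of_real (E r / D r) = of_real (- 1 / 2)" by (rule arg_cong)
    then have "complex_of_real (E r) / of_real (D r) = - 1 / 2" by simp
    then show "complex_of_real r * deriv (deriv (bessel_h \<nu>)) (of_real r) / deriv (bessel_h \<nu>) (of_real r) = - 1 / 2"
      unfolding deriv_bessel_h(2)[OF \<nu>] unfolding deriv_bessel_h(1)[OF \<nu>]
      by (simp only: pow_series_of_real[OF e] pow_series_of_real[OF en] D_def E_def)
  qed
  moreover have "is_least_pos_zero (uc_lhs_J \<nu>) r"
    unfolding is_least_pos_zero_def
  proof (intro conjI allI impI)
    show "uc_lhs_J \<nu> r = 0" using uc[of r] r(1,3) by simp
    fix y assume "0 < y \<and> y < r"
    then show "uc_lhs_J \<nu> y \<noteq> 0" using uc[of y] r(4)[of y] by simp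
  qed (rule r(1))
  moreover have "is_least_pos_zero (\<lambda>x. dini \<nu> (complex_of_real x)) \<beta>"
    unfolding is_least_pos_zero_def
  proof (intro conjI allI impI)
    show "dini \<nu> (of_real \<beta>) = 0" using dini0 \<beta>(1,3) by simp
    fix y assume "0 < y \<and> y < \<beta>"
    then show "dini \<nu> (of_real y) \<noteq> 0" using dini0[of y] \<beta>(4)[of y] by simp
  qed (rule \<beta>(1))
  moreover have "is_least_pos_zero (\<lambda>x. bessel_J \<nu> (complex_of_real x)) j"
    unfolding is_least_pos_zero_def
  proof (intro conjI allI impI)
    show "bessel_J \<nu> (of_real j) = 0" using J0 j(1,2) by simp
    fix y assume "0 < y \<and> y < j"
    then show "bessel_J \<nu> (of_real y) \<noteq> 0" using J0[of y] j(3)[of y] by simp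
  qed (rule j(1))
  ultimately show ?thesis using r\<beta> \<beta>j
    by (intro exI[of _ r] exI[of _ \<beta>] exI[of _ j] conjI)
qed

section \<open>The case -2 < \<nu> < -1\<close>

text \<open>From the value 1 at the origin the function falls at least at rate \<open>c 1\<close>,
  so it is nonpositive at \<open>1 / c 1\<close>. Strict monotonicity gives uniqueness and the signs
  on both sides.\<close>

lemma pow_series_minus_zero_exists:
  assumes c: "entire_coeffs c" "\<And>n. n \<ge> 1 \<Longrightarrow> (-1) ^ n * c n \<le> 0" "c 0 = 1" "c 1 > 0"
  obtains x :: real where "x > 0" "pow_series c (- x) = 0"
    "\<And>y. 0 \<le> y \<Longrightarrow> y < x \<Longrightarrow> pow_series c (- y) > 0" "\<And>y. x < y \<Longrightarrow> pow_series c (- y) < 0"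
proof -
  have c0: "pow_series c (- 0) = (1 :: real)" by (simp add: pow_series_0 c)
  have dec: "pow_series c (- y) < pow_series c (- x)" if "0 \<le> x" "x < y" for x y :: real
  proof -
    have "0 < c 1 * (y - x)" using that c(4) by simp
    also have "\<dots> \<le> pow_series c (- x) - pow_series c (- y)" using that by (intro pow_series_minus_decreasing c) auto
    finally show ?thesis by simp
  qed
  have "c 1 * (1 / c 1 - 0) \<le> pow_series c (- 0) - pow_series c (- (1 / c 1) :: real)"
    using c(4) by (intro pow_series_minus_decreasing c) auto
  then have "pow_series c (- (1 / c 1) :: real) \<le> 0" using c0 c(4) by simp
  moreover have "continuous_on {0..1 / c 1} (\<lambda>x::real. pow_series c (- x))"
    by (intro continuous_intros c)
  ultimately obtain x :: real where x: "0 \<le> x" "pow_series c (- x) = 0"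
    using IVT2'[of "\<lambda>x. pow_series c (- x)" "1 / c 1" 0 0] c0 c(4) by auto
  have "x \<noteq> 0" using x c0 by auto
  then have "x > 0" using x(1) by simp
  moreover have "pow_series c (- y) > 0" if "0 \<le> y" "y < x" for y using dec[OF that] x(2) by simp
  moreover have "pow_series c (- y) < 0" if "x < y" for y using dec[OF x(1) that] x(2) by simp
  ultimately show ?thesis using that x(2) by blast
qed

lemma bessel_uc_radius_neg:
  assumes "-2 < \<nu>" "\<nu> < -1"
  shows "\<exists>b>0. {z. z \<noteq> 0 \<and> Re z = 0 \<and> dini \<nu> z = 0}
                 = {\<i> * complex_of_real b, - (\<i> * complex_of_real b)} \<and>
          (\<exists>r. {s \<in> {0<..<b\<^sup>2}. uc_lhs_I \<nu> s = 0} = {r} \<and>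
             radius_uniform_convexity (bessel_h \<nu>) = ereal r)"
proof -
  have \<nu>: "\<nu> > -2" "\<nu> \<noteq> -1" using assms by auto
  note e = entire_dh_coeff[OF \<nu>]
  note en = entire_coeffs_nat_mult[OF e]
  define D E where "D = (\<lambda>x::real. pow_series (dh_coeff \<nu>) (- x))"
    and "E = (\<lambda>x::real. pow_series (\<lambda>n. real n * dh_coeff \<nu> n) (- x))"
  \<comment> \<open>The cleared equation \<open>D + 2 E\<close> is again a series with the sign
    pattern of \<open>h'\<close>, so existence and uniqueness of its root come from the same lemma
    as for \<open>b\<close>.\<close>
  define k where "k = (\<lambda>n. dh_coeff \<nu> n + 2 * (real n * dh_coeff \<nu> n))"
  have ek: "entire_coeffs k" unfolding k_def by (intro entire_coeffs_add entire_coeffs_scale e en)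
  have k: "pow_series k (- x) = D x + 2 * E x" for x
    unfolding k_def D_def E_def using pow_series_add[OF e entire_coeffs_scale[OF en, of 2], of "- x"] pow_series_scale[OF en, of 2 "- x"]
    by simp
  have E_sign: "(-1) ^ n * (real n * dh_coeff \<nu> n) \<le> 0" if "n \<ge> 1" for n
    using mult_nonneg_nonpos[OF _ dh_coeff_sign(1)[OF assms that], of "real n"] by (simp add: mult_ac)
  have k_sign: "(-1) ^ n * k n \<le> 0" if "n \<ge> 1" for n
    using E_sign[OF that] dh_coeff_sign(1)[OF assms that] by (simp add: k_def distrib_left)
  have E_neg: "E x < 0" if "x > 0" for x
  proof -
    have "0 < dh_coeff \<nu> 1 * x" using that dh_coeff_sign(2)[OF assms] by simp
    also have "\<dots> \<le> E 0 - E x"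
      using pow_series_minus_decreasing[OF en E_sign, of 0 x] that by (simp add: E_def)
    also have "E 0 = 0" by (simp add: E_def pow_series_0)
    finally show ?thesis by simp
  qed
  obtain B where B: "B > 0" "D B = 0" "\<And>y. 0 \<le> y \<Longrightarrow> y < B \<Longrightarrow> D y > 0" "\<And>y. B < y \<Longrightarrow> D y < 0"
    using pow_series_minus_zero_exists[OF e dh_coeff_sign(1,3,2)[OF assms]] unfolding D_def by blast
  have k01: "k 0 = 1" "k 1 > 0" using dh_coeff_sign(2,3)[OF assms] by (auto simp: k_def)
  obtain R where R: "R > 0" "D R + 2 * E R = 0" "\<And>y. 0 \<le> y \<Longrightarrow> y < R \<Longrightarrow> D y + 2 * E y > 0"
      "\<And>y. R < y \<Longrightarrow> D y + 2 * E y < 0"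
    using pow_series_minus_zero_exists[OF ek k_sign k01] unfolding k by blast
  \<comment> \<open>At \<open>B\<close> the term \<open>D\<close> vanishes while \<open>E\<close> is
    negative, so \<open>D + 2 E\<close> has already changed sign.\<close>
  have "R < B"
  proof (rule ccontr)
    assume "\<not> R < B"
    then have "D B + 2 * E B \<ge> 0" using R(2) R(3)[of B] B(1) by (cases "B = R") auto
    with B E_neg[of B] show False by simp
  qed
  define b where "b = sqrt B"
  have b: "b > 0" "b\<^sup>2 = B" using B by (auto simp: b_def)

  have "{z. z \<noteq> 0 \<and> Re z = 0 \<and> dini \<nu> z = 0} = {\<i> * complex_of_real b, - (\<i> * complex_of_real b)}"
  proof -
    have "dini \<nu> (\<i> * of_real y) = 0 \<longleftrightarrow> y = b \<or> y = - b" if "y \<noteq> 0" for y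
    proof -
      have "dini \<nu> (\<i> * of_real y) = 0 \<longleftrightarrow> pow_series (dh_coeff \<nu>) (complex_of_real (- (y\<^sup>2))) = 0"
        using that by (subst dini_eq_0_iff[OF \<nu>]) (auto simp: complex_nonpos_Reals_iff power_mult_distrib)
      also have "\<dots> \<longleftrightarrow> D (y\<^sup>2) = 0"
        by (simp only: pow_series_of_real[OF e] of_real_eq_0_iff D_def)
      also have "\<dots> \<longleftrightarrow> y\<^sup>2 = b\<^sup>2"
        using B(2) B(3)[of "y\<^sup>2"] B(4)[of "y\<^sup>2"] by (cases "y\<^sup>2" B rule: linorder_cases) (auto simp: b(2))
      finally show ?thesis by (simp add: power2_eq_iff)
    qed
    note * = this
    show ?thesis
    proof (intro set_eqI iffI)
      fix z assume z: "z \<in> {z. z \<noteq> 0 \<and> Re z = 0 \<and> dini \<nu> z = 0}"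
      then have "z = \<i> * of_real (Im z)" "Im z \<noteq> 0" by (auto simp: complex_eq_iff)
      with *[of "Im z"] z show "z \<in> {\<i> * complex_of_real b, - (\<i> * complex_of_real b)}"
        by (auto simp: complex_eq_iff)
    next
      fix z assume "z \<in> {\<i> * complex_of_real b, - (\<i> * complex_of_real b)}"
      with *[of b] *[of "- b"] b(1) show "z \<in> {z. z \<noteq> 0 \<and> Re z = 0 \<and> dini \<nu> z = 0}" by auto
    qed
  qed
  moreover have "{s \<in> {0<..<b\<^sup>2}. uc_lhs_I \<nu> s = 0} = {R}"
  proof -
    have "uc_lhs_I \<nu> s = 0 \<longleftrightarrow> s = R" if "0 < s" "s < B" for s
    proof -
      have "D s > 0" using B(3) that by simp
      moreover have "uc_lhs_I \<nu> s = of_real (1 + 2 * E s / D s)"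
        using uc_lhs_I_eq[OF \<nu> that(1)] by (simp add: D_def E_def)
      ultimately have "uc_lhs_I \<nu> s = 0 \<longleftrightarrow> D s + 2 * E s = 0"
        by (simp only: of_real_eq_0_iff) (simp add: field_simps)
      then show ?thesis using R(2) R(3)[of s] R(4)[of s] that by (cases s R rule: linorder_cases) auto
    qed
    with \<open>R < B\<close> R(1) b(2) show ?thesis by auto
  qed
  moreover have "radius_uniform_convexity (bessel_h \<nu>) = ereal R"
  proof (rule radius_uniform_convexity_eqI[OF R(1) conv_radius_bessel_h[OF \<nu>]])
    fix z :: complex assume z: "norm z < R"
    have DR: "0 < pow_series (dh_coeff \<nu>) (- R)" using B(3)[of R] R(1) \<open>R < B\<close> by (simp add: D_def)
    note bounds = dh_bounds_neg[OF assms z DR]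
    have "0 < (1 - norm z / R)\<^sup>2" using z R(1) by simp
    then have nz: "pow_series (dh_coeff \<nu>) z \<noteq> 0" using bounds(1) by auto
    moreover have "norm (pow_series (\<lambda>n. real n * dh_coeff \<nu> n) z / pow_series (dh_coeff \<nu>) z) < 1 / 2"
      using R(3)[of "norm z"] B(3)[of "norm z"] z \<open>R < B\<close>
      by (intro norm_div_less_half[OF bounds(2) _ _ nz]) (auto simp: D_def E_def)
    ultimately show "deriv (bessel_h \<nu>) z \<noteq> 0 \<and>
        norm (z * deriv (deriv (bessel_h \<nu>)) z / deriv (bessel_h \<nu>) z) < 1 / 2"
      unfolding deriv_bessel_h(2)[OF \<nu>] unfolding deriv_bessel_h(1)[OF \<nu>] by blast
  next
    show "norm (complex_of_real (- R)) = R" using R(1) by simp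
    have "E R / D R = - 1 / 2" using R(1,2) B(3)[of R] \<open>R < B\<close> by (simp add: field_simps)
    then have "complex_of_real (E R / D R) = of_real (- 1 / 2)" by (rule arg_cong)
    then have "complex_of_real (E R) / of_real (D R) = - 1 / 2" by simp
    then show "complex_of_real (- R) * deriv (deriv (bessel_h \<nu>)) (of_real (- R)) / deriv (bessel_h \<nu>) (of_real (- R)) = - 1 / 2"
      unfolding deriv_bessel_h(2)[OF \<nu>] unfolding deriv_bessel_h(1)[OF \<nu>]
      by (simp only: pow_series_of_real[OF e] pow_series_of_real[OF en] D_def E_def)
  qed
  ultimately show ?thesis using b(1)
    by (intro exI[of _ b] exI[of _ R] conjI)
qed

theorem theorem3p3:
  fixes \<nu> :: real
  shows
    "(\<nu> > -1 \<longrightarrow>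
       (\<exists>r \<beta> j. is_least_pos_zero (uc_lhs_J \<nu>) r \<and>
          is_least_pos_zero (\<lambda>x. dini \<nu> (complex_of_real x)) \<beta> \<and>
          is_least_pos_zero (\<lambda>x. bessel_J \<nu> (complex_of_real x)) j \<and>
          radius_uniform_convexity (bessel_h \<nu>) = ereal r \<and>
          r < \<beta>\<^sup>2 \<and> \<beta>\<^sup>2 < j\<^sup>2)) \<and>
     (-2 < \<nu> \<and> \<nu> < -1 \<longrightarrow>
       (\<exists>b>0. {z. z \<noteq> 0 \<and> Re z = 0 \<and> dini \<nu> z = 0}
                 = {\<i> * complex_of_real b, - (\<i> * complex_of_real b)} \<and>
          (\<exists>r. {s \<in> {0<..<b\<^sup>2}. uc_lhs_I \<nu> s = 0} = {r} \<and>
             radius_uniform_convexity (bessel_h \<nu>) = ereal r)))"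
proof (intro conjI impI)
  assume "\<nu> > -1"
  then show "\<exists>r \<beta> j. is_least_pos_zero (uc_lhs_J \<nu>) r \<and>
          is_least_pos_zero (\<lambda>x. dini \<nu> (complex_of_real x)) \<beta> \<and>
          is_least_pos_zero (\<lambda>x. bessel_J \<nu> (complex_of_real x)) j \<and>
          radius_uniform_convexity (bessel_h \<nu>) = ereal r \<and>
          r < \<beta>\<^sup>2 \<and> \<beta>\<^sup>2 < j\<^sup>2"
    by (rule bessel_uc_radius_pos)
next
  assume "-2 < \<nu> \<and> \<nu> < -1"
  then show "\<exists>b>0. {z. z \<noteq> 0 \<and> Re z = 0 \<and> dini \<nu> z = 0}
                 = {\<i> * complex_of_real b, - (\<i> * complex_of_real b)} \<and>
          (\<exists>r. {s \<in> {0<..<b\<^sup>2}. uc_lhs_I \<nu> s = 0} = {r} \<and>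
             radius_uniform_convexity (bessel_h \<nu>) = ereal r)"
    using bessel_uc_radius_neg by blast
qed

end
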